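(* There is a functor $O$ from the category of 3-dimensional complex inner product spaces with normalized complex volume form, with unitary operators preserving the volume form as morphisms, to the category of real algebras isomorphic to the octonions $\mathbb{O}$ equipped with a chosen square root of $-1$, with algebra isomorphisms preserving this chosen square root of $-1$ as morphisms, sending $V$ to $\mathbb{C}\oplus V$ given the product $$(\alpha,\mathbf{a})(\beta,\mathbf{b})=(\alpha\beta-\langle\mathbf{a},\mathbf{b}\rangle,\ \alpha\mathbf{b}+\beta\mathbf{a}+\mathbf{a}\,\overline{\times}\,\mathbf{b})\qquad(\alpha,\beta\in\mathbb{C},\ \mathbf{a},\mathbf{b}\in V).$$ This functor $O$ is an equivalence of categories.
   Context: All vector spaces are finite-dimensional. An algebra means a vector space with a bilinear, not necessarily associative, product and a unit element $1$. The octonions $\mathbb{O}$ are the unique (up to isomorphism) 8-dimensional normed division algebra over $\mathbb{R}$. Let $V$ be a 3-dimensional complex vector space with a complex inner product $\langle-,-\rangle\colon V\times V\to\mathbb{C}$, with the convention that it is complex-linear in the second argument (and conjugate-linear in the first). It induces an inner product on each grade $\Lambda^nV^*$ of the exterior algebra of $V^*$. A normalized complex volume form on $V$ is an element $\omega\in\Lambda^3V^*$ with $\langle\omega,\omega\rangle=1$. The map $\overline{\times}\colon V\times V\to V$ is the antisymmetric conjugate-bilinear map determined by $\langle\mathbf{a}\,\overline{\times}\,\mathbf{b},\mathbf{c}\rangle=\omega(\mathbf{a},\mathbf{b},\mathbf{c})$ for all $\mathbf{a},\mathbf{b},\mathbf{c}\in V$. Choosing a square root of $-1$ in an algebra $A$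 is the same as choosing a monomorphism of algebras $\mathbb{C}\hookrightarrow A$; for $\mathbb{C}\oplus V$ the chosen square root of $-1$ is $(i,0)$, corresponding to the summand $\mathbb{C}$.
   Formalization: The second component of the product is taken as ᾱb + βa + a×̄b (first scalar conjugated): as printed with αb, (i,0) would commute with every element of ℂ⊕V, so ℂ⊕V could not be isomorphic to the octonions. *)

theory Defs
  imports "HOL-Analysis.Euclidean_Space" "Jordan_Normal_Form.VS_Connect"
begin

section \<open>Categories, functors, equivalences\<close>

record ('o, 'm) category =
  Obj :: "'o set"
  Hom :: "'o \<Rightarrow> 'o \<Rightarrow> 'm set"
  Ident :: "'o \<Rightarrow> 'm"
  Comp :: "'o \<Rightarrow> 'o \<Rightarrow> 'o \<Rightarrow> 'm \<Rightarrow> 'm \<Rightarrow> 'm"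

text \<open>\<open>Comp C X Y Z g f\<close> is the composite of \<open>f : X \<rightarrow> Y\<close> and \<open>g : Y \<rightarrow> Z\<close>.\<close>

locale category =
  fixes C :: "('o, 'm) category"
  assumes Ident_in_Hom: "X \<in> Obj C \<Longrightarrow> Ident C X \<in> Hom C X X"
    and Comp_in_Hom: "\<lbrakk>X \<in> Obj C; Y \<in> Obj C; Z \<in> Obj C; f \<in> Hom C X Y; g \<in> Hom C Y Z\<rbrakk>
      \<Longrightarrow> Comp C X Y Z g f \<in> Hom C X Z"
    and Comp_Ident_left: "\<lbrakk>X \<in> Obj C; Y \<in> Obj C; f \<in> Hom C X Y\<rbrakk>
      \<Longrightarrow> Comp C X Y Y (Ident C Y) f = f"
    and Comp_Ident_right: "\<lbrakk>X \<in> Obj C; Y \<in> Obj C; f \<in> Hom C X Y\<rbrakk>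
      \<Longrightarrow> Comp C X X Y f (Ident C X) = f"
    and Comp_assoc: "\<lbrakk>W \<in> Obj C; X \<in> Obj C; Y \<in> Obj C; Z \<in> Obj C;
        f \<in> Hom C W X; g \<in> Hom C X Y; h \<in> Hom C Y Z\<rbrakk>
      \<Longrightarrow> Comp C W Y Z h (Comp C W X Y g f) = Comp C W X Z (Comp C X Y Z h g) f"

definition isos :: "('o, 'm) category \<Rightarrow> 'o \<Rightarrow> 'o \<Rightarrow> 'm set" where
  "isos C X Y = {f \<in> Hom C X Y. \<exists>g \<in> Hom C Y X.
     Comp C X Y X g f = Ident C X \<and> Comp C Y X Y f g = Ident C Y}"

record ('o, 'm, 'p, 'n) fctr =
  on_obj :: "'o \<Rightarrow> 'p"
  on_arr :: "'o \<Rightarrow> 'o \<Rightarrow> 'm \<Rightarrow> 'n"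

definition is_functor ::
    "('o, 'm) category \<Rightarrow> ('p, 'n) category \<Rightarrow> ('o, 'm, 'p, 'n) fctr \<Rightarrow> bool" where
  "is_functor C D F \<longleftrightarrow> category C \<and> category D \<and>
     (\<forall>X \<in> Obj C. on_obj F X \<in> Obj D) \<and>
     (\<forall>X \<in> Obj C. \<forall>Y \<in> Obj C. \<forall>f \<in> Hom C X Y.
        on_arr F X Y f \<in> Hom D (on_obj F X) (on_obj F Y)) \<and>
     (\<forall>X \<in> Obj C. on_arr F X X (Ident C X) = Ident D (on_obj F X)) \<and>
     (\<forall>X \<in> Obj C. \<forall>Y \<in> Obj C. \<forall>Z \<in> Obj C. \<forall>f \<in> Hom C X Y. \<forall>g \<in> Hom C Y Z.
        on_arr F X Z (Comp C X Y Z g f) =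
        Comp D (on_obj F X) (on_obj F Y) (on_obj F Z) (on_arr F Y Z g) (on_arr F X Y f))"

definition id_fctr :: "('o, 'm, 'o, 'm) fctr" where
  "id_fctr = \<lparr>on_obj = (\<lambda>X. X), on_arr = (\<lambda>X Y f. f)\<rparr>"

definition comp_fctr ::
    "('p, 'n, 'q, 'k) fctr \<Rightarrow> ('o, 'm, 'p, 'n) fctr \<Rightarrow> ('o, 'm, 'q, 'k) fctr" where
  "comp_fctr G F = \<lparr>on_obj = (\<lambda>X. on_obj G (on_obj F X)),
     on_arr = (\<lambda>X Y f. on_arr G (on_obj F X) (on_obj F Y) (on_arr F X Y f))\<rparr>"

definition naturally_isomorphic :: "('o, 'm) category \<Rightarrow> ('p, 'n) category \<Rightarrow>
    ('o, 'm, 'p, 'n) fctr \<Rightarrow> ('o, 'm, 'p, 'n) fctr \<Rightarrow> bool" where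
  "naturally_isomorphic C D F G \<longleftrightarrow> (\<exists>\<eta>.
     (\<forall>X \<in> Obj C. \<eta> X \<in> isos D (on_obj F X) (on_obj G X)) \<and>
     (\<forall>X \<in> Obj C. \<forall>Y \<in> Obj C. \<forall>f \<in> Hom C X Y.
        Comp D (on_obj F X) (on_obj F Y) (on_obj G Y) (\<eta> Y) (on_arr F X Y f) =
        Comp D (on_obj F X) (on_obj G X) (on_obj G Y) (on_arr G X Y f) (\<eta> X)))"

definition is_equivalence ::
    "('o, 'm) category \<Rightarrow> ('p, 'n) category \<Rightarrow> ('o, 'm, 'p, 'n) fctr \<Rightarrow> bool" where
  "is_equivalence C D F \<longleftrightarrow> is_functor C D F \<and>
     (\<exists>G. is_functor D C G \<and>
        naturally_isomorphic C C (comp_fctr G F) id_fctr \<and>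
        naturally_isomorphic D D (comp_fctr F G) id_fctr)"


section \<open>Complex inner product spaces with a normalized volume form\<close>

text \<open>The records extend \<^type>\<open>Module.module\<close>, as in the library's theory of vector spaces with
  carrier; for these spaces its ring fields \<open>mult\<close> and \<open>one\<close> carry no information.\<close>

record 'v ip_space = "(complex, 'v) Module.module" +
  ip :: "'v \<Rightarrow> 'v \<Rightarrow> complex"

record 'v vol_space = "'v ip_space" +
  vol :: "'v \<Rightarrow> 'v \<Rightarrow> 'v \<Rightarrow> complex"

locale inner_product_space = vectorspace "class_ring :: complex ring" V
  for V :: "('v, 'z) ip_space_scheme" +
  assumes ip_add: "\<lbrakk>a \<in> carrier V; b \<in> carrier V; c \<in> carrier V\<rbrakk>
      \<Longrightarrow> ip V a (b \<oplus>\<^bsub>V\<^esub> c) = ip V a b + ip V a c"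
    and ip_smult: "\<lbrakk>a \<in> carrier V; b \<in> carrier V\<rbrakk> \<Longrightarrow> ip V a (z \<odot>\<^bsub>V\<^esub> b) = z * ip V a b"
    and ip_cnj: "\<lbrakk>a \<in> carrier V; b \<in> carrier V\<rbrakk> \<Longrightarrow> ip V b a = cnj (ip V a b)"
    and ip_pos: "\<lbrakk>a \<in> carrier V; a \<noteq> \<zero>\<^bsub>V\<^esub>\<rbrakk> \<Longrightarrow> 0 < Re (ip V a a)"

text \<open>Elements of \<open>\<Lambda>\<^sup>3 V\<^sup>*\<close> are represented by alternating trilinear forms.\<close>

definition alt_form3 ::
    "(complex, 'v, 'z) Module.module_scheme \<Rightarrow> ('v \<Rightarrow> 'v \<Rightarrow> 'v \<Rightarrow> complex) \<Rightarrow> bool" where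
  "alt_form3 V \<mu> \<longleftrightarrow>
     (\<forall>a \<in> carrier V. \<forall>b \<in> carrier V. \<forall>c \<in> carrier V. \<forall>d \<in> carrier V.
        \<mu> (a \<oplus>\<^bsub>V\<^esub> d) b c = \<mu> a b c + \<mu> d b c \<and>
        \<mu> a (b \<oplus>\<^bsub>V\<^esub> d) c = \<mu> a b c + \<mu> a d c \<and>
        \<mu> a b (c \<oplus>\<^bsub>V\<^esub> d) = \<mu> a b c + \<mu> a b d) \<and>
     (\<forall>z. \<forall>a \<in> carrier V. \<forall>b \<in> carrier V. \<forall>c \<in> carrier V.
        \<mu> (z \<odot>\<^bsub>V\<^esub> a) b c = z * \<mu> a b c \<and>
        \<mu> a (z \<odot>\<^bsub>V\<^esub> b) c = z * \<mu> a b c \<and>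
        \<mu> a b (z \<odot>\<^bsub>V\<^esub> c) = z * \<mu> a b c) \<and>
     (\<forall>a \<in> carrier V. \<forall>b \<in> carrier V. \<mu> a a b = 0 \<and> \<mu> a b a = 0 \<and> \<mu> b a a = 0)"

definition orthonormal_basis :: "('v, 'z) ip_space_scheme \<Rightarrow> 'v set \<Rightarrow> bool" where
  "orthonormal_basis V B \<longleftrightarrow> vectorspace.basis (class_ring :: complex ring) V B \<and>
     (\<forall>a \<in> B. \<forall>b \<in> B. ip V a b = (if a = b then 1 else 0))"

text \<open>The inner product on \<open>\<Lambda>\<^sup>3 V\<^sup>*\<close> induced by that of \<open>V\<close>, for which the forms
  \<open>e\<^sup>i \<and> e\<^sup>j \<and> e\<^sup>k\<close> with \<open>i < j < k\<close> are orthonormal when \<open>e\<^sup>1, \<dots>, e\<^sup>n\<close> is the dual of an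
  orthonormal basis \<open>e\<^sub>1, \<dots>, e\<^sub>n\<close>; here \<open>(e\<^sup>i \<and> e\<^sup>j \<and> e\<^sup>k)(e\<^sub>i, e\<^sub>j, e\<^sub>k) = 1\<close>, and the factor
  compensates for summing over all triples instead of increasing ones.\<close>

definition form3_ip :: "('v, 'z) ip_space_scheme \<Rightarrow>
    ('v \<Rightarrow> 'v \<Rightarrow> 'v \<Rightarrow> complex) \<Rightarrow> ('v \<Rightarrow> 'v \<Rightarrow> 'v \<Rightarrow> complex) \<Rightarrow> complex" where
  "form3_ip V \<mu> \<nu> = (let B = (SOME B. orthonormal_basis V B) in
     (\<Sum>a\<in>B. \<Sum>b\<in>B. \<Sum>c\<in>B. cnj (\<mu> a b c) * \<nu> a b c) / 6)"

text \<open>The choice of the orthonormal basis does not matter, by \<open>form3_ip_eq\<close>.\<close>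

lemma (in inner_product_space) linear_expand:
  assumes B: "orthonormal_basis V B" "finite B" and x: "x \<in> carrier V"
    and add: "\<And>a b. a \<in> carrier V \<Longrightarrow> b \<in> carrier V \<Longrightarrow> f (a \<oplus>\<^bsub>V\<^esub> b) = f a + f b"
    and sc: "\<And>z a. a \<in> carrier V \<Longrightarrow> f (z \<odot>\<^bsub>V\<^esub> a) = z * f a"
  shows "f x = (\<Sum>b\<in>B. ip V b x * (f b :: complex))"
proof -
  have bas: "basis B" and on: "\<And>a b. a \<in> B \<Longrightarrow> b \<in> B \<Longrightarrow> ip V a b = (if a = b then 1 else 0)"
    using B by (auto simp: orthonormal_basis_def)
  have BV: "B \<subseteq> carrier V" and gen: "gen_set B" using bas by (auto simp: basis_def)
  obtain c where c: "x = lincomb c B"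
    using finite_span[OF B(2) BV] gen x by auto
  have lin: "g (lincomb c A) = (\<Sum>b\<in>A. c b * g b)"
    if "finite A" "A \<subseteq> carrier V"
      and add: "\<And>a b. a \<in> carrier V \<Longrightarrow> b \<in> carrier V \<Longrightarrow> g (a \<oplus>\<^bsub>V\<^esub> b) = g a + g b"
      and sc: "\<And>z a. a \<in> carrier V \<Longrightarrow> g (z \<odot>\<^bsub>V\<^esub> a) = z * (g a :: complex)" for g A
    using that(1,2)
  proof (induction A rule: finite_induct)
    case empty
    have "g \<zero>\<^bsub>V\<^esub> = 0" using add[of "\<zero>\<^bsub>V\<^esub>" "\<zero>\<^bsub>V\<^esub>"] by simp
    then show ?case by (simp add: lincomb_def)
  next
    case (insert b A)
    have "lincomb c (insert b A) = c b \<odot>\<^bsub>V\<^esub> b \<oplus>\<^bsub>V\<^esub> lincomb c A"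
      unfolding lincomb_def using insert by (subst finsum_insert) auto
    moreover have "lincomb c A \<in> carrier V"
      unfolding lincomb_def using insert by (intro finsum_closed) auto
    ultimately show ?case using insert by (simp add: add sc)
  qed
  have "ip V b x = c b" if b: "b \<in> B" for b
  proof -
    have "ip V b (lincomb c B) = (\<Sum>a\<in>B. c a * ip V b a)"
      using b BV B(2) by (intro lin) (auto intro!: ip_add ip_smult)
    also have "\<dots> = (\<Sum>a\<in>B. if a = b then c b else 0)"
      using b by (intro sum.cong) (auto simp: on)
    also have "\<dots> = c b" using b B(2) by simp
    finally show ?thesis using c by simp
  qed
  moreover have "f x = (\<Sum>b\<in>B. c b * f b)"
    unfolding c by (intro lin B(2) BV add sc)
  ultimately show ?thesis by simp
qed

lemma (in inner_product_space) sum_basis_cong: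
  assumes B: "orthonormal_basis V B" "finite B" and B': "orthonormal_basis V B'" "finite B'"
    and f: "\<And>a b. a \<in> carrier V \<Longrightarrow> b \<in> carrier V \<Longrightarrow> f (a \<oplus>\<^bsub>V\<^esub> b) = f a + f b"
      "\<And>z a. a \<in> carrier V \<Longrightarrow> f (z \<odot>\<^bsub>V\<^esub> a) = z * f a"
    and g: "\<And>a b. a \<in> carrier V \<Longrightarrow> b \<in> carrier V \<Longrightarrow> g (a \<oplus>\<^bsub>V\<^esub> b) = g a + g b"
      "\<And>z a. a \<in> carrier V \<Longrightarrow> g (z \<odot>\<^bsub>V\<^esub> a) = z * g a"
  shows "(\<Sum>b\<in>B. cnj (f b) * g b) = (\<Sum>b\<in>B'. cnj (f b) * (g b :: complex))"
proof -
  have BV: "B \<subseteq> carrier V" "B' \<subseteq> carrier V"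
    using B B' by (auto simp: orthonormal_basis_def basis_def)
  have "(\<Sum>b\<in>B'. cnj (f b) * g b) = (\<Sum>b\<in>B'. cnj (f b) * (\<Sum>c\<in>B. ip V c b * g c))"
    using BV by (intro sum.cong refl arg_cong2[where f="(*)"] linear_expand[OF B] g) auto
  also have "\<dots> = (\<Sum>c\<in>B. cnj (\<Sum>b\<in>B'. ip V b c * f b) * g c)"
  proof -
    have "(\<Sum>b\<in>B'. cnj (f b) * (\<Sum>c\<in>B. ip V c b * g c)) =
      (\<Sum>b\<in>B'. \<Sum>c\<in>B. cnj (ip V b c * f b) * g c)"
      unfolding sum_distrib_left
      using BV by (intro sum.cong refl) (simp add: ip_cnj[of _ _, symmetric] subset_iff mult_ac)
    also have "\<dots> = (\<Sum>c\<in>B. \<Sum>b\<in>B'. cnj (ip V b c * f b) * g c)" by (rule sum.swap)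
    finally show ?thesis by (simp add: sum_distrib_right)
  qed
  also have "\<dots> = (\<Sum>c\<in>B. cnj (f c) * g c)"
    using BV by (intro sum.cong refl arg_cong2[where f="(*)"] arg_cong[where f=cnj]
      linear_expand[OF B', symmetric] f) auto
  finally show ?thesis by simp
qed

lemma (in inner_product_space) form3_ip_eq:
  assumes "fin_dim" and \<mu>: "alt_form3 V \<mu>" and \<nu>: "alt_form3 V \<nu>" and B: "orthonormal_basis V B"
  shows "form3_ip V \<mu> \<nu> = (\<Sum>a\<in>B. \<Sum>b\<in>B. \<Sum>c\<in>B. cnj (\<mu> a b c) * \<nu> a b c) / 6"
proof -
  define B' where "B' = (SOME B. orthonormal_basis V B)"
  have B': "orthonormal_basis V B'" unfolding B'_def using B by (rule someI)
  have fin: "finite B" "finite B'" and BV: "B \<subseteq> carrier V" "B' \<subseteq> carrier V"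
    using B B' fin_dim_li_fin[OF assms(1)] by (auto simp: orthonormal_basis_def basis_def)
  note eq = sum_basis_cong[OF B' fin(2) B fin(1)]
  have "(\<Sum>a\<in>B'. \<Sum>b\<in>B'. \<Sum>c\<in>B'. cnj (\<mu> a b c) * \<nu> a b c) =
        (\<Sum>a\<in>B'. \<Sum>b\<in>B'. \<Sum>c\<in>B. cnj (\<mu> a b c) * \<nu> a b c)"
    using BV \<mu> \<nu> by (intro sum.cong refl eq) (simp_all add: alt_form3_def subset_iff)
  also have "\<dots> = (\<Sum>a\<in>B'. \<Sum>c\<in>B. \<Sum>b\<in>B'. cnj (\<mu> a b c) * \<nu> a b c)"
    by (intro sum.cong refl sum.swap)
  also have "\<dots> = (\<Sum>a\<in>B'. \<Sum>c\<in>B. \<Sum>b\<in>B. cnj (\<mu> a b c) * \<nu> a b c)"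
    using BV \<mu> \<nu> by (intro sum.cong refl eq) (simp_all add: alt_form3_def subset_iff)
  also have "\<dots> = (\<Sum>c\<in>B. \<Sum>b\<in>B. \<Sum>a\<in>B'. cnj (\<mu> a b c) * \<nu> a b c)"
    by (subst sum.swap, intro sum.cong refl sum.swap)
  also have "\<dots> = (\<Sum>c\<in>B. \<Sum>b\<in>B. \<Sum>a\<in>B. cnj (\<mu> a b c) * \<nu> a b c)"
    using BV \<mu> \<nu> by (intro sum.cong refl eq) (simp_all add: alt_form3_def subset_iff)
  also have "\<dots> = (\<Sum>b\<in>B. \<Sum>c\<in>B. \<Sum>a\<in>B. cnj (\<mu> a b c) * \<nu> a b c)"
    by (rule sum.swap)
  also have "\<dots> = (\<Sum>b\<in>B. \<Sum>a\<in>B. \<Sum>c\<in>B. cnj (\<mu> a b c) * \<nu> a b c)"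
    by (intro sum.cong refl sum.swap)
  also have "\<dots> = (\<Sum>a\<in>B. \<Sum>b\<in>B. \<Sum>c\<in>B. cnj (\<mu> a b c) * \<nu> a b c)"
    by (rule sum.swap)
  finally show ?thesis by (simp add: form3_ip_def B'_def Let_def)
qed

locale volume_space = inner_product_space V for V :: "'v vol_space" +
  assumes fin_dim: "fin_dim"
    and dim_3: "dim = 3"
    and vol_alt: "alt_form3 V (vol V)"
    and vol_normalized: "form3_ip V (vol V) (vol V) = 1"

definition cross :: "'v vol_space \<Rightarrow> 'v \<Rightarrow> 'v \<Rightarrow> 'v" where
  "cross V a b = (THE v. v \<in> carrier V \<and> (\<forall>c \<in> carrier V. ip V v c = vol V a b c))"

text \<open>Morphisms are extensional functions, so that equality of morphisms is equality on the
  carrier.\<close>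

definition unitary_vol :: "'v vol_space \<Rightarrow> 'v vol_space \<Rightarrow> ('v \<Rightarrow> 'v) set" where
  "unitary_vol V W = {f \<in> LinearCombinations.module_hom class_ring V W \<inter> extensional (carrier V).
     bij_betw f (carrier V) (carrier W) \<and>
     (\<forall>a \<in> carrier V. \<forall>b \<in> carrier V. ip W (f a) (f b) = ip V a b) \<and>
     (\<forall>a \<in> carrier V. \<forall>b \<in> carrier V. \<forall>c \<in> carrier V. vol W (f a) (f b) (f c) = vol V a b c)}"

definition volume_cat :: "('v vol_space, 'v \<Rightarrow> 'v) category" where
  "volume_cat = \<lparr>Obj = {V. volume_space V}, Hom = unitary_vol,
     Ident = (\<lambda>V. \<lambda>a\<in>carrier V. a), Comp = (\<lambda>U V W g f. compose (carrier U) g f)\<rparr>"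


section \<open>Algebras and the octonions\<close>

locale nonassoc_algebra = vectorspace "class_ring :: real ring" A
  for A :: "(real, 'a, 'z) Module.module_scheme" (structure) +
  assumes fin_dim: "fin_dim"
    and mult_closed: "\<lbrakk>x \<in> carrier A; y \<in> carrier A\<rbrakk> \<Longrightarrow> x \<otimes> y \<in> carrier A"
    and mult_add_left: "\<lbrakk>x \<in> carrier A; y \<in> carrier A; z \<in> carrier A\<rbrakk>
      \<Longrightarrow> (x \<oplus> y) \<otimes> z = (x \<otimes> z) \<oplus> (y \<otimes> z)"
    and mult_add_right: "\<lbrakk>x \<in> carrier A; y \<in> carrier A; z \<in> carrier A\<rbrakk>
      \<Longrightarrow> x \<otimes> (y \<oplus> z) = (x \<otimes> y) \<oplus> (x \<otimes> z)"
    and mult_smult_left: "\<lbrakk>x \<in> carrier A; y \<in> carrier A\<rbrakk>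
      \<Longrightarrow> (r \<odot>\<^bsub>A\<^esub> x) \<otimes> y = r \<odot>\<^bsub>A\<^esub> (x \<otimes> y)"
    and mult_smult_right: "\<lbrakk>x \<in> carrier A; y \<in> carrier A\<rbrakk>
      \<Longrightarrow> x \<otimes> (r \<odot>\<^bsub>A\<^esub> y) = r \<odot>\<^bsub>A\<^esub> (x \<otimes> y)"
    and unit_closed: "\<one> \<in> carrier A"
    and unit_left: "x \<in> carrier A \<Longrightarrow> \<one> \<otimes> x = x"
    and unit_right: "x \<in> carrier A \<Longrightarrow> x \<otimes> \<one> = x"

definition algebra_iso :: "(real, 'a, 'y) Module.module_scheme \<Rightarrow>
    (real, 'b, 'z) Module.module_scheme \<Rightarrow> ('a \<Rightarrow> 'b) set" where
  "algebra_iso A B = {f \<in> LinearCombinations.module_hom class_ring A B.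
     bij_betw f (carrier A) (carrier B) \<and> f \<one>\<^bsub>A\<^esub> = \<one>\<^bsub>B\<^esub> \<and>
     (\<forall>x \<in> carrier A. \<forall>y \<in> carrier A. f (x \<otimes>\<^bsub>A\<^esub> y) = f x \<otimes>\<^bsub>B\<^esub> f y)}"

text \<open>The octonions, by Cayley--Dickson doubling of \<open>\<complex>\<close> and of the resulting quaternions.\<close>

type_synonym quat = "complex \<times> complex"
type_synonym octo = "quat \<times> quat"

fun quat_cnj :: "quat \<Rightarrow> quat" where
  "quat_cnj (a, b) = (cnj a, - b)"

fun quat_mult :: "quat \<Rightarrow> quat \<Rightarrow> quat" where
  "quat_mult (a, b) (c, d) = (a * c - cnj d * b, d * a + b * cnj c)"

fun octo_mult :: "octo \<Rightarrow> octo \<Rightarrow> octo" where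
  "octo_mult (p, q) (r, s) = (quat_mult p r - quat_mult (quat_cnj s) q,
     quat_mult s p + quat_mult q (quat_cnj r))"

definition octonions :: "(real, octo) Module.module" where
  "octonions = \<lparr>carrier = UNIV, mult = octo_mult, one = ((1, 0), (0, 0)),
     zero = 0, add = (+), smult = scaleR\<rparr>"

lemma norm_octo_mult: "norm (octo_mult x y) = norm x * norm y"
proof -
  have "(norm (octo_mult x y))\<^sup>2 = (norm x * norm y)\<^sup>2"
  proof -
    obtain a b c d where x: "x = ((a, b), (c, d))" by (metis surj_pair)
    obtain a' b' c' d' where y: "y = ((a', b'), (c', d'))" by (metis surj_pair)
    show ?thesis
      unfolding x y
      apply (simp add: norm_prod_def cmod_power2 power_mult_distrib)
      apply (simp add: algebra_simps power2_eq_square)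
      done
  qed
  then show ?thesis
    by (smt (verit) norm_ge_zero power2_eq_imp_eq mult_nonneg_nonneg)
qed

lemma DIM_octo: "DIM(octo) = 8"
  by simp

lemma octo_center:
  assumes "\<And>y. octo_mult x y = octo_mult y x"
  shows "\<exists>r. x = r *\<^sub>R ((1, 0), (0, 0))"
proof -
  obtain a b c d where x: "x = ((a, b), (c, d))" by (metis surj_pair)
  show ?thesis
    using assms[of "((\<i>, 0), 0)"] assms[of "((0, 1), 0)"] assms[of "(0, (1, 0))"]
    by (auto simp: x complex_eq_iff zero_prod_def intro!: exI[of _ "Re a"])
qed

lemma nonassoc_algebra_octonions: "nonassoc_algebra octonions"
proof -
  have sel: "carrier octonions = UNIV" "zero octonions = 0" "add octonions = (+)"
    "smult octonions = scaleR"
    by (simp_all add: octonions_def)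
  have vs: "vectorspace class_ring octonions"
  proof -
    have "\<exists>y. x + y = 0" for x :: octo by (rule exI[of _ "- x"]) simp
    then have "module class_ring octonions"
      by (intro Module.moduleI class_cring.cring_axioms abelian_groupI)
         (auto simp: octonions_def algebra_simps class_ring_simps)
    then show ?thesis
      by (simp add: vectorspace_def class_field.field_axioms)
  qed
  interpret vectorspace "class_ring :: real ring" octonions by (rule vs)
  have fs: "finsum octonions f A = sum f A" if "finite A" for f :: "octo \<Rightarrow> octo" and A
    using that by (induction A rule: finite_induct) (simp_all add: sel)
  have fd: "fin_dim"
    unfolding fin_dim_def
  proof (intro exI conjI)
    show "gen_set (Basis :: octo set)"
    proof -
      have "x \<in> span Basis" for x :: octo
      proof -
        have "lincomb (inner x) Basis = x"
          by (simp add: lincomb_def fs sel euclidean_representation)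
        then show ?thesis
          unfolding span_def by (auto intro!: exI[of _ "inner x"] exI[of _ Basis])
      qed
      then show ?thesis by (auto simp: octonions_def)
    qed
  qed (auto simp: octonions_def)
  show ?thesis
    by unfold_locales (use fd in \<open>auto simp: octonions_def algebra_simps scaleR_conv_of_real\<close>)
qed

record 'a rooted_algebra = "(real, 'a) Module.module" +
  root :: 'a

definition octonion_objs :: "'a rooted_algebra set" where
  "octonion_objs = {A. nonassoc_algebra A \<and> algebra_iso A octonions \<noteq> {} \<and>
     root A \<in> carrier A \<and> root A \<otimes>\<^bsub>A\<^esub> root A = \<ominus>\<^bsub>A\<^esub> \<one>\<^bsub>A\<^esub>}"

definition rooted_iso :: "'a rooted_algebra \<Rightarrow> 'a rooted_algebra \<Rightarrow> ('a \<Rightarrow> 'a) set" where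
  "rooted_iso A B = {f \<in> algebra_iso A B \<inter> extensional (carrier A). f (root A) = root B}"

definition octonion_cat :: "('a rooted_algebra, 'a \<Rightarrow> 'a) category" where
  "octonion_cat = \<lparr>Obj = octonion_objs, Hom = rooted_iso,
     Ident = (\<lambda>A. \<lambda>x\<in>carrier A. x), Comp = (\<lambda>A B C g f. compose (carrier A) g f)\<rparr>"


section \<open>The functor\<close>

text \<open>The first scalar has to be conjugated: with \<open>\<alpha> b + \<beta> a + a \<times> b\<close> as second component,
  \<open>(\<i>, 0)\<close> would commute with everything, contrary to \<open>octo_center\<close>. As the inner product is
  conjugate-linear in its first argument, \<open>cnj \<alpha> b + \<beta> a + a \<times> b\<close> is what makes
  \<open>\<bar>\<alpha>\<bar>\<^sup>2 + \<langle>a, a\<rangle>\<close> multiplicative.\<close>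

definition O_obj :: "'v vol_space \<Rightarrow> (complex \<times> 'v) rooted_algebra" where
  "O_obj V = \<lparr>carrier = UNIV \<times> carrier V,
     mult = (\<lambda>(\<alpha>, a) (\<beta>, b).
       (\<alpha> * \<beta> - ip V a b,
        cnj \<alpha> \<odot>\<^bsub>V\<^esub> b \<oplus>\<^bsub>V\<^esub> \<beta> \<odot>\<^bsub>V\<^esub> a \<oplus>\<^bsub>V\<^esub> cross V a b)),
     one = (1, \<zero>\<^bsub>V\<^esub>),
     zero = (0, \<zero>\<^bsub>V\<^esub>),
     add = (\<lambda>(\<alpha>, a) (\<beta>, b). (\<alpha> + \<beta>, a \<oplus>\<^bsub>V\<^esub> b)),
     smult = (\<lambda>r (\<alpha>, a). (of_real r * \<alpha>, of_real r \<odot>\<^bsub>V\<^esub> a)),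
     root = (\<i>, \<zero>\<^bsub>V\<^esub>)\<rparr>"

definition O_arr ::
    "'v vol_space \<Rightarrow> 'v vol_space \<Rightarrow> ('v \<Rightarrow> 'v) \<Rightarrow> (complex \<times> 'v \<Rightarrow> complex \<times> 'v)" where
  "O_arr V W f = (\<lambda>(\<alpha>, a)\<in>UNIV \<times> carrier V. (\<alpha>, f a))"

definition O_fctr ::
    "('v vol_space, 'v \<Rightarrow> 'v, (complex \<times> 'v) rooted_algebra, complex \<times> 'v \<Rightarrow> complex \<times> 'v) fctr"
  where "O_fctr = \<lparr>on_obj = O_obj, on_arr = O_arr\<rparr>"

end

theory Submission
  imports Defs "HOL-Analysis.Linear_Algebra"
begin

text \<open>
  The functor \<open>O\<close> is an equivalence because it is fully faithful and essentially surjective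
  (\<open>fully_faithful_essentially_surjective_imp_equivalence\<close>).

  Computations in \<open>V\<close> and in \<open>\<complex> \<oplus> V\<close> are done in coordinates: every space with a normalized volume
  form has an orthonormal basis on which the form takes the value \<open>1\<close>
  (\<open>unimodular_frame_exists\<close>). This identifies it with \<open>\<complex>\<^sup>3\<close>, its form with the determinant, and
  its cross product with the conjugate of the usual one. In such coordinates an explicit real
  linear bijection turns the Cayley--Dickson product into the product of \<open>\<complex> \<oplus> V\<close>
  (\<open>from_octonions_iso\<close>), so that \<open>\<complex> \<oplus> V\<close> is a copy of the octonions.

  The functor is full because \<open>V\<close> can be recovered from the algebra with its root \<open>\<i>\<close>: the summand
  \<open>\<complex>\<close> is spanned over the reals by \<open>1\<close> and \<open>\<i>\<close>, the summand \<open>V\<close> consists of the elements anticommuting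
  with \<open>\<i>\<close>, and products of vectors encode the inner product and the cross product
  (\<open>O_arr_full\<close>).

  It is essentially surjective because all square roots of \<open>-1\<close> in the octonions are equivalent
  under automorphisms (\<open>octo_automorphism_exists\<close>): any of them generates a copy of \<open>\<complex>\<close>, and
  doubling it twice with unit vectors orthogonal to what is already there reproduces the
  octonions, by the identities valid in every algebra with a multiplicative norm.
\<close>

section \<open>A criterion for equivalences of categories\<close>

text \<open>A quasi-inverse \<open>G\<close> is assembled from choices: an object \<open>G A\<close> with an isomorphism
  \<open>e A : F (G A) \<rightarrow> A\<close> for every \<open>A\<close>, and for \<open>g : A \<rightarrow> B\<close> the unique \<open>F\<close>-preimage of
  \<open>(e B)\<^sup>-\<^sup>1 g (e A)\<close>. Uniqueness of preimages makes every functor law and every naturality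
  square a statement about \<open>F\<close>-images, where it follows by cancelling the isomorphisms \<open>e\<close>.\<close>

lemma fully_faithful_essentially_surjective_imp_equivalence:
  fixes C :: "('o, 'm) category" and D :: "('p, 'n) category"
  assumes F: "is_functor C D F"
    and full: "\<And>X Y g. X \<in> Obj C \<Longrightarrow> Y \<in> Obj C \<Longrightarrow> g \<in> Hom D (on_obj F X) (on_obj F Y)
      \<Longrightarrow> \<exists>f \<in> Hom C X Y. on_arr F X Y f = g"
    and faithful: "\<And>X Y f f'. X \<in> Obj C \<Longrightarrow> Y \<in> Obj C \<Longrightarrow> f \<in> Hom C X Y \<Longrightarrow> f' \<in> Hom C X Y
      \<Longrightarrow> on_arr F X Y f = on_arr F X Y f' \<Longrightarrow> f = f'"
    and ess_surj: "\<And>A. A \<in> Obj D \<Longrightarrow> \<exists>X \<in> Obj C. isos D (on_obj F X) A \<noteq> {}"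
  shows "is_equivalence C D F"
proof -
  interpret C: category C using F by (simp add: is_functor_def)
  interpret D: category D using F by (simp add: is_functor_def)
  have F_obj: "on_obj F X \<in> Obj D" if "X \<in> Obj C" for X
    using F that by (simp add: is_functor_def)
  have F_arr: "on_arr F X Y f \<in> Hom D (on_obj F X) (on_obj F Y)"
    if "X \<in> Obj C" "Y \<in> Obj C" "f \<in> Hom C X Y" for X Y f
    using F that by (simp add: is_functor_def)
  have F_id: "on_arr F X X (Ident C X) = Ident D (on_obj F X)" if "X \<in> Obj C" for X
    using F that by (simp add: is_functor_def)
  have F_comp: "on_arr F X Z (Comp C X Y Z g f) =
      Comp D (on_obj F X) (on_obj F Y) (on_obj F Z) (on_arr F Y Z g) (on_arr F X Y f)"
    if "X \<in> Obj C" "Y \<in> Obj C" "Z \<in> Obj C" "f \<in> Hom C X Y" "g \<in> Hom C Y Z" for X Y Z f g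
    using F that by (simp add: is_functor_def)
  define G0 where "G0 A = (SOME X. X \<in> Obj C \<and> isos D (on_obj F X) A \<noteq> {})" for A
  have G0: "G0 A \<in> Obj C \<and> isos D (on_obj F (G0 A)) A \<noteq> {}" if "A \<in> Obj D" for A
    unfolding G0_def by (rule someI_ex) (use ess_surj[OF that] in auto)
  define FG where "FG A = on_obj F (G0 A)" for A
  have G_obj: "G0 A \<in> Obj C" "FG A \<in> Obj D" if "A \<in> Obj D" for A
    using G0[OF that] F_obj by (auto simp: FG_def)
  define e where "e A = (SOME h. h \<in> isos D (FG A) A)" for A
  have "e A \<in> isos D (FG A) A" if "A \<in> Obj D" for A
    unfolding e_def by (rule someI_ex) (use G0[OF that] in \<open>auto simp: FG_def\<close>)
  then have "\<exists>k. \<forall>A \<in> Obj D. e A \<in> Hom D (FG A) A \<and> k A \<in> Hom D A (FG A) \<and>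
      Comp D (FG A) A (FG A) (k A) (e A) = Ident D (FG A) \<and>
      Comp D A (FG A) A (e A) (k A) = Ident D A"
    unfolding isos_def by (intro bchoice) blast
  then obtain k where "\<forall>A \<in> Obj D. e A \<in> Hom D (FG A) A \<and> k A \<in> Hom D A (FG A) \<and>
      Comp D (FG A) A (FG A) (k A) (e A) = Ident D (FG A) \<and>
      Comp D A (FG A) A (e A) (k A) = Ident D A" by blast
  then have e: "e A \<in> Hom D (FG A) A" and k: "k A \<in> Hom D A (FG A)"
    and ke: "Comp D (FG A) A (FG A) (k A) (e A) = Ident D (FG A)"
    and ek: "Comp D A (FG A) A (e A) (k A) = Ident D A" if "A \<in> Obj D" for A
    using that by auto
  define pre where "pre X Y g = (SOME f. f \<in> Hom C X Y \<and> on_arr F X Y f = g)" for X Y g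
  have pre: "pre X Y g \<in> Hom C X Y" "on_arr F X Y (pre X Y g) = g"
    if "X \<in> Obj C" "Y \<in> Obj C" "g \<in> Hom D (on_obj F X) (on_obj F Y)" for X Y g
  proof -
    have "pre X Y g \<in> Hom C X Y \<and> on_arr F X Y (pre X Y g) = g"
      unfolding pre_def by (rule someI_ex) (use full[OF that] in auto)
    then show "pre X Y g \<in> Hom C X Y" "on_arr F X Y (pre X Y g) = g" by auto
  qed
  \<comment> \<open>The \<open>F\<close>-image that the arrow map of \<open>G\<close> must have for \<open>e\<close> to be natural.\<close>
  define conj where "conj A B g = Comp D (FG A) B (FG B) (k B) (Comp D (FG A) A B g (e A))"
    for A B g
  have conj_in: "conj A B g \<in> Hom D (FG A) (FG B)"
    if "A \<in> Obj D" "B \<in> Obj D" "g \<in> Hom D A B" for A B g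
    unfolding conj_def using that G_obj e k by (intro D.Comp_in_Hom) auto
  have e_conj: "Comp D (FG A) (FG B) B (e B) (conj A B g) = Comp D (FG A) A B g (e A)"
    if "A \<in> Obj D" "B \<in> Obj D" "g \<in> Hom D A B" for A B g
  proof -
    have m: "Comp D (FG A) A B g (e A) \<in> Hom D (FG A) B"
      using that G_obj e by (intro D.Comp_in_Hom) auto
    have "Comp D (FG A) (FG B) B (e B) (conj A B g) =
      Comp D (FG A) B B (Comp D B (FG B) B (e B) (k B)) (Comp D (FG A) A B g (e A))"
      unfolding conj_def using that G_obj e k m by (intro D.Comp_assoc) auto
    also have "\<dots> = Comp D (FG A) A B g (e A)"
      using that m G_obj by (simp add: ek D.Comp_Ident_left)
    finally show ?thesis .
  qed
  have conj_unique: "h = conj A B g"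
    if "A \<in> Obj D" "B \<in> Obj D" "g \<in> Hom D A B" "h \<in> Hom D (FG A) (FG B)"
      and eq: "Comp D (FG A) (FG B) B (e B) h = Comp D (FG A) A B g (e A)" for A B g h
  proof -
    have "conj A B g = Comp D (FG A) B (FG B) (k B) (Comp D (FG A) (FG B) B (e B) h)"
      unfolding conj_def eq ..
    also have "\<dots> = Comp D (FG A) (FG B) (FG B) (Comp D (FG B) B (FG B) (k B) (e B)) h"
      using that G_obj e k by (intro D.Comp_assoc) auto
    also have "\<dots> = h"
      using that G_obj by (simp add: ke D.Comp_Ident_left)
    finally show ?thesis by simp
  qed
  define G where "G = \<lparr>on_obj = G0, on_arr = (\<lambda>A B g. pre (G0 A) (G0 B) (conj A B g))\<rparr>"
  have G_arr: "on_arr G A B g \<in> Hom C (G0 A) (G0 B)"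
    "on_arr F (G0 A) (G0 B) (on_arr G A B g) = conj A B g"
    if "A \<in> Obj D" "B \<in> Obj D" "g \<in> Hom D A B" for A B g
    using pre[of "G0 A" "G0 B" "conj A B g"] conj_in[OF that] that G_obj
    by (auto simp: G_def FG_def)
  have G_id: "on_arr G A A (Ident D A) = Ident C (G0 A)" if A: "A \<in> Obj D" for A
  proof (rule faithful[OF G_obj(1)[OF A] G_obj(1)[OF A]])
    show "on_arr G A A (Ident D A) \<in> Hom C (G0 A) (G0 A)"
      using A by (intro G_arr D.Ident_in_Hom)
    show "Ident C (G0 A) \<in> Hom C (G0 A) (G0 A)" using G_obj A by (intro C.Ident_in_Hom)
    have "Ident D (FG A) = conj A A (Ident D A)"
      using A G_obj e by (intro conj_unique D.Ident_in_Hom)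
        (auto simp: D.Comp_Ident_left D.Comp_Ident_right)
    then show "on_arr F (G0 A) (G0 A) (on_arr G A A (Ident D A)) =
        on_arr F (G0 A) (G0 A) (Ident C (G0 A))"
      using A G_obj by (simp add: G_arr D.Ident_in_Hom F_id FG_def)
  qed
  have G_comp: "on_arr G A E (Comp D A B E h g) =
      Comp C (G0 A) (G0 B) (G0 E) (on_arr G B E h) (on_arr G A B g)"
    if A: "A \<in> Obj D" "B \<in> Obj D" "E \<in> Obj D" and g: "g \<in> Hom D A B" and h: "h \<in> Hom D B E"
    for A B E g h
  proof (rule faithful[OF G_obj(1)[OF A(1)] G_obj(1)[OF A(3)]])
    have hg: "Comp D A B E h g \<in> Hom D A E" using A g h by (intro D.Comp_in_Hom)
    show "on_arr G A E (Comp D A B E h g) \<in> Hom C (G0 A) (G0 E)"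
      using A hg by (intro G_arr)
    show "Comp C (G0 A) (G0 B) (G0 E) (on_arr G B E h) (on_arr G A B g) \<in> Hom C (G0 A) (G0 E)"
      using A g h G_obj by (intro C.Comp_in_Hom G_arr) auto
    \<comment> \<open>Composites satisfy the equation that characterizes the conjugate of \<open>h \<circ> g\<close>.\<close>
    note c = conj_in[OF A(1,2) g] conj_in[OF A(2,3) h]
    have "Comp D (FG A) (FG B) (FG E) (conj B E h) (conj A B g) = conj A E (Comp D A B E h g)"
    proof (rule conj_unique[OF A(1,3) hg])
      show "Comp D (FG A) (FG B) (FG E) (conj B E h) (conj A B g) \<in> Hom D (FG A) (FG E)"
        using A G_obj c by (intro D.Comp_in_Hom) auto
      have "Comp D (FG A) (FG E) E (e E) (Comp D (FG A) (FG B) (FG E) (conj B E h) (conj A B g))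
        = Comp D (FG A) (FG B) E (Comp D (FG B) (FG E) E (e E) (conj B E h)) (conj A B g)"
        using A G_obj c e by (intro D.Comp_assoc) auto
      also have "\<dots> = Comp D (FG A) (FG B) E (Comp D (FG B) B E h (e B)) (conj A B g)"
        using A h by (simp add: e_conj)
      also have "\<dots> = Comp D (FG A) B E h (Comp D (FG A) (FG B) B (e B) (conj A B g))"
        using A G_obj c e h by (intro D.Comp_assoc[symmetric]) auto
      also have "\<dots> = Comp D (FG A) B E h (Comp D (FG A) A B g (e A))"
        using A g by (simp add: e_conj)
      also have "\<dots> = Comp D (FG A) A E (Comp D A B E h g) (e A)"
        using A G_obj e g h by (intro D.Comp_assoc) auto
      finally show "Comp D (FG A) (FG E) E (e E)
          (Comp D (FG A) (FG B) (FG E) (conj B E h) (conj A B g)) =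
        Comp D (FG A) A E (Comp D A B E h g) (e A)" .
    qed
    then show "on_arr F (G0 A) (G0 E) (on_arr G A E (Comp D A B E h g)) =
      on_arr F (G0 A) (G0 E) (Comp C (G0 A) (G0 B) (G0 E) (on_arr G B E h) (on_arr G A B g))"
      using A g h hg G_obj by (simp add: F_comp G_arr FG_def)
  qed
  have G: "is_functor D C G"
    unfolding is_functor_def
    using C.category_axioms D.category_axioms G_obj G_arr G_id G_comp by (simp add: G_def)
  have FG_iso: "naturally_isomorphic D D (comp_fctr F G) id_fctr"
    unfolding naturally_isomorphic_def
  proof (intro exI[of _ e] conjI ballI)
    fix A assume A: "A \<in> Obj D"
    show "e A \<in> isos D (on_obj (comp_fctr F G) A) (on_obj id_fctr A)"
      using e[OF A] k[OF A] ek[OF A] ke[OF A]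
      by (auto simp: isos_def comp_fctr_def id_fctr_def G_def FG_def)
  next
    fix A B g assume A: "A \<in> Obj D" "B \<in> Obj D" "g \<in> Hom D A B"
    have *: "on_arr F (G0 A) (G0 B) (on_arr G A B g) = conj A B g"
      using A by (rule G_arr)
    show "Comp D (on_obj (comp_fctr F G) A) (on_obj (comp_fctr F G) B) (on_obj id_fctr B) (e B)
        (on_arr (comp_fctr F G) A B g) =
      Comp D (on_obj (comp_fctr F G) A) (on_obj id_fctr A) (on_obj id_fctr B)
        (on_arr id_fctr A B g) (e A)"
      using e_conj[OF A] *
      by (simp add: comp_fctr_def id_fctr_def FG_def G_def)
  qed
  have GF_iso: "naturally_isomorphic C C (comp_fctr G F) id_fctr"
    unfolding naturally_isomorphic_def
  \<comment> \<open>The natural isomorphism \<open>G (F X) \<rightarrow> X\<close> is the \<open>F\<close>-preimage of \<open>e (F X)\<close>.\<close>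
  proof (intro exI[of _ "\<lambda>X. pre (G0 (on_obj F X)) X (e (on_obj F X))"] conjI ballI)
    fix X assume X: "X \<in> Obj C"
    let ?A = "on_obj F X"
    have A: "?A \<in> Obj D" "G0 ?A \<in> Obj C" using X F_obj G_obj by auto
    have p: "pre (G0 ?A) X (e ?A) \<in> Hom C (G0 ?A) X"
      "on_arr F (G0 ?A) X (pre (G0 ?A) X (e ?A)) = e ?A"
      using pre[of "G0 ?A" X "e ?A"] A X e by (auto simp: FG_def)
    have q: "pre X (G0 ?A) (k ?A) \<in> Hom C X (G0 ?A)"
      "on_arr F X (G0 ?A) (pre X (G0 ?A) (k ?A)) = k ?A"
      using pre[of X "G0 ?A" "k ?A"] A X k by (auto simp: FG_def)
    have "Comp C (G0 ?A) X (G0 ?A) (pre X (G0 ?A) (k ?A)) (pre (G0 ?A) X (e ?A)) =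
        Ident C (G0 ?A)"
      by (rule faithful[OF A(2) A(2)])
        (use A X p q ke[OF A(1)] in \<open>auto intro!: C.Comp_in_Hom C.Ident_in_Hom
          simp: F_comp F_id FG_def\<close>)
    moreover have "Comp C X (G0 ?A) X (pre (G0 ?A) X (e ?A)) (pre X (G0 ?A) (k ?A)) = Ident C X"
      by (rule faithful[OF X X])
        (use A X p q ek[OF A(1)] in \<open>auto intro!: C.Comp_in_Hom C.Ident_in_Hom
          simp: F_comp F_id FG_def\<close>)
    ultimately show "pre (G0 ?A) X (e ?A) \<in> isos C (on_obj (comp_fctr G F) X) (on_obj id_fctr X)"
      using p q by (auto simp: isos_def comp_fctr_def id_fctr_def G_def)
  next
    fix X Y f assume X: "X \<in> Obj C" "Y \<in> Obj C" and f: "f \<in> Hom C X Y"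
    let ?A = "on_obj F X" and ?B = "on_obj F Y"
    have A: "?A \<in> Obj D" "G0 ?A \<in> Obj C" "?B \<in> Obj D" "G0 ?B \<in> Obj C"
      using X F_obj G_obj by auto
    have g: "on_arr F X Y f \<in> Hom D ?A ?B" using X f by (rule F_arr)
    let ?Gf = "on_arr G ?A ?B (on_arr F X Y f)"
    have Gf: "?Gf \<in> Hom C (G0 ?A) (G0 ?B)" "on_arr F (G0 ?A) (G0 ?B) ?Gf = conj ?A ?B (on_arr F X Y f)"
      using A g G_arr by auto
    have p: "pre (G0 ?A) X (e ?A) \<in> Hom C (G0 ?A) X"
      "on_arr F (G0 ?A) X (pre (G0 ?A) X (e ?A)) = e ?A"
      using pre[of "G0 ?A" X "e ?A"] A X e by (auto simp: FG_def)
    have q: "pre (G0 ?B) Y (e ?B) \<in> Hom C (G0 ?B) Y"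
      "on_arr F (G0 ?B) Y (pre (G0 ?B) Y (e ?B)) = e ?B"
      using pre[of "G0 ?B" Y "e ?B"] A X e by (auto simp: FG_def)
    have "Comp C (G0 ?A) (G0 ?B) Y (pre (G0 ?B) Y (e ?B)) ?Gf =
        Comp C (G0 ?A) X Y f (pre (G0 ?A) X (e ?A))"
      by (rule faithful[OF A(2) X(2)])
        (use A X f p q Gf e_conj[OF A(1,3) g] in \<open>auto intro!: C.Comp_in_Hom
          simp: F_comp FG_def\<close>)
    then show "Comp C (on_obj (comp_fctr G F) X) (on_obj (comp_fctr G F) Y) (on_obj id_fctr Y)
        (pre (G0 ?B) Y (e ?B)) (on_arr (comp_fctr G F) X Y f) =
      Comp C (on_obj (comp_fctr G F) X) (on_obj id_fctr X) (on_obj id_fctr Y)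
        (on_arr id_fctr X Y f) (pre (G0 ?A) X (e ?A))"
      by (simp add: comp_fctr_def id_fctr_def G_def)
  qed
  show ?thesis
    unfolding is_equivalence_def using F G FG_iso GF_iso by blast
qed

section \<open>Isomorphisms of nonassociative algebras\<close>

lemma algebra_isoD:
  assumes "f \<in> algebra_iso A B"
  shows "x \<in> carrier A \<Longrightarrow> f x \<in> carrier B"
    and "x \<in> carrier A \<Longrightarrow> y \<in> carrier A \<Longrightarrow> f (x \<oplus>\<^bsub>A\<^esub> y) = f x \<oplus>\<^bsub>B\<^esub> f y"
    and "x \<in> carrier A \<Longrightarrow> f (r \<odot>\<^bsub>A\<^esub> x) = r \<odot>\<^bsub>B\<^esub> f x"
    and "x \<in> carrier A \<Longrightarrow> y \<in> carrier A \<Longrightarrow> f (x \<otimes>\<^bsub>A\<^esub> y) = f x \<otimes>\<^bsub>B\<^esub> f y"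
    and "f \<one>\<^bsub>A\<^esub> = \<one>\<^bsub>B\<^esub>" "bij_betw f (carrier A) (carrier B)"
    and "f \<in> LinearCombinations.module_hom class_ring A B"
  using assms by (auto simp: algebra_iso_def module_hom_def)

lemma algebra_isoI:
  assumes "bij_betw f (carrier A) (carrier B)"
    and "\<And>x y. x \<in> carrier A \<Longrightarrow> y \<in> carrier A \<Longrightarrow> f (x \<oplus>\<^bsub>A\<^esub> y) = f x \<oplus>\<^bsub>B\<^esub> f y"
    and "\<And>r x. x \<in> carrier A \<Longrightarrow> f (r \<odot>\<^bsub>A\<^esub> x) = r \<odot>\<^bsub>B\<^esub> f x"
    and "\<And>x y. x \<in> carrier A \<Longrightarrow> y \<in> carrier A \<Longrightarrow> f (x \<otimes>\<^bsub>A\<^esub> y) = f x \<otimes>\<^bsub>B\<^esub> f y"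
    and "f \<one>\<^bsub>A\<^esub> = \<one>\<^bsub>B\<^esub>"
  shows "f \<in> algebra_iso A B"
  using assms bij_betwE[OF assms(1)] by (auto simp: algebra_iso_def module_hom_def)

lemma algebra_iso_comp:
  assumes "f \<in> algebra_iso A B" "g \<in> algebra_iso B C"
  shows "g \<circ> f \<in> algebra_iso A C"
proof (rule algebra_isoI)
  show "bij_betw (g \<circ> f) (carrier A) (carrier C)"
    using assms[THEN algebra_isoD(6)] by (rule bij_betw_trans)
qed (auto simp: algebra_isoD(1-5)[OF assms(1)] algebra_isoD(1-5)[OF assms(2)])

context nonassoc_algebra
begin

lemma algebra_iso_restrict:
  assumes "f \<in> algebra_iso A B"
  shows "restrict f (carrier A) \<in> algebra_iso A B"
  using assms
  by (intro algebra_isoI)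
    (auto simp: algebra_isoD[OF assms] mult_closed unit_closed cong: bij_betw_cong)

lemma algebra_iso_inverse:
  assumes f: "f \<in> algebra_iso A B"
  shows "inv_into (carrier A) f \<in> algebra_iso B A"
proof (rule algebra_isoI)
  let ?g = "inv_into (carrier A) f"
  note hom = algebra_isoD(2-5)[OF f] and bij = algebra_isoD(6)[OF f]
  show "bij_betw ?g (carrier B) (carrier A)" using bij by (rule bij_betw_inv_into)
  have img: "\<exists>x' \<in> carrier A. x = f x'" if "x \<in> carrier B" for x
    using bij that by (auto simp: bij_betw_def)
  have gf: "?g (f x) = x" if "x \<in> carrier A" for x
    using bij that by (simp add: bij_betw_def inv_into_f_f)
  show "?g (x \<oplus>\<^bsub>B\<^esub> y) = ?g x \<oplus> ?g y" if "x \<in> carrier B" "y \<in> carrier B" for x y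
    using img[OF that(1)] img[OF that(2)] by (auto simp: gf simp flip: hom)
  show "?g (r \<odot>\<^bsub>B\<^esub> x) = r \<odot>\<^bsub>A\<^esub> ?g x" if "x \<in> carrier B" for r x
    using img[OF that] by (auto simp: gf simp flip: hom)
  show "?g (x \<otimes>\<^bsub>B\<^esub> y) = ?g x \<otimes> ?g y" if "x \<in> carrier B" "y \<in> carrier B" for x y
    using img[OF that(1)] img[OF that(2)] by (auto simp: gf mult_closed simp flip: hom)
  show "?g \<one>\<^bsub>B\<^esub> = \<one>"
    using gf[OF unit_closed] by (simp add: hom)
qed

text \<open>The algebra axioms for \<open>B\<close> are images under \<open>f\<close> of those for \<open>A\<close>; only finite dimensionality
  needs a fact about linear maps. That \<open>f\<close> maps zero to zero has to be assumed, since \<open>zero\<close>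
  is a field of the record that nothing ties to the addition of \<open>B\<close> beforehand.\<close>

lemma transport_along_iso:
  fixes B :: "(real, 'b, 'y) Module.module_scheme"
  assumes f: "f \<in> algebra_iso A B" and zero: "f \<zero> = \<zero>\<^bsub>B\<^esub>"
  shows "nonassoc_algebra B"
proof -
  note hom = algebra_isoD(2-5)[OF f] and closed = algebra_isoD(1)[OF f]
    and bij = algebra_isoD(6)[OF f]
  have img: "\<exists>x' \<in> carrier A. x = f x'" if "x \<in> carrier B" for x
    using bij that by (auto simp: bij_betw_def)
  have "module class_ring B"
  proof (intro Module.moduleI class_cring.cring_axioms abelian_groupI)
    show "\<zero>\<^bsub>B\<^esub> \<in> carrier B" using closed[of \<zero>] zero by simp
    show "x \<oplus>\<^bsub>B\<^esub> y \<in> carrier B" if "x \<in> carrier B" "y \<in> carrier B" for x y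
      using that[THEN img] by (auto simp: closed simp flip: hom)
    show "x \<oplus>\<^bsub>B\<^esub> y \<oplus>\<^bsub>B\<^esub> z = x \<oplus>\<^bsub>B\<^esub> (y \<oplus>\<^bsub>B\<^esub> z)"
      if "x \<in> carrier B" "y \<in> carrier B" "z \<in> carrier B" for x y z
      using that[THEN img] by (auto simp: a_assoc simp flip: hom)
    show "x \<oplus>\<^bsub>B\<^esub> y = y \<oplus>\<^bsub>B\<^esub> x" if "x \<in> carrier B" "y \<in> carrier B" for x y
      using that[THEN img] by (auto simp: M.a_comm simp flip: hom)
    show "\<zero>\<^bsub>B\<^esub> \<oplus>\<^bsub>B\<^esub> x = x" if "x \<in> carrier B" for x
      using img[OF that] by (auto simp flip: hom zero)
    show "\<exists>y \<in> carrier B. y \<oplus>\<^bsub>B\<^esub> x = \<zero>\<^bsub>B\<^esub>" if x: "x \<in> carrier B" for x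
    proof -
      obtain x' where x': "x' \<in> carrier A" "x = f x'" using img[OF x] by blast
      then have "f (\<ominus> x') \<oplus>\<^bsub>B\<^esub> x = \<zero>\<^bsub>B\<^esub>"
        using hom(1)[of "\<ominus> x'" x'] by (simp add: M.l_neg zero)
      then show ?thesis using closed[of "\<ominus> x'"] x' by auto
    qed
  qed (auto dest!: img simp: closed class_ring_simps smult_l_distr[simplified] smult_r_distr
      smult_assoc1[simplified] smult_one[simplified] simp flip: hom)
  then have vs: "vectorspace class_ring B"
    by (simp add: vectorspace_def class_field.field_axioms)
  interpret B: vectorspace "class_ring :: real ring" B by (rule vs)
  have fd: "B.fin_dim"
  proof -
    interpret T: linear_map "class_ring :: real ring" A B f
      using algebra_isoD(7)[OF f] by unfold_locales
    show ?thesis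
      using T.rank_nullity_main(2)[OF fin_dim] bij by (simp add: bij_betw_def)
  qed
  show ?thesis
  proof
    show "B.fin_dim" by (rule fd)
    fix x y z and r :: real
    {
      assume "x \<in> carrier B" "y \<in> carrier B" "z \<in> carrier B"
      from this[THEN img] obtain x' y' z' where
        x: "x' \<in> carrier A" "x = f x'" and y: "y' \<in> carrier A" "y = f y'"
        and z: "z' \<in> carrier A" "z = f z'" by blast
      show "(x \<oplus>\<^bsub>B\<^esub> y) \<otimes>\<^bsub>B\<^esub> z = (x \<otimes>\<^bsub>B\<^esub> z) \<oplus>\<^bsub>B\<^esub> (y \<otimes>\<^bsub>B\<^esub> z)"
        "x \<otimes>\<^bsub>B\<^esub> (y \<oplus>\<^bsub>B\<^esub> z) = (x \<otimes>\<^bsub>B\<^esub> y) \<oplus>\<^bsub>B\<^esub> (x \<otimes>\<^bsub>B\<^esub> z)"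
        using x y z by (simp_all add: mult_add_left mult_add_right mult_closed flip: hom(1,3))
    }
    {
      assume "x \<in> carrier B" "y \<in> carrier B"
      from this[THEN img] obtain x' y' where
        x: "x' \<in> carrier A" "x = f x'" and y: "y' \<in> carrier A" "y = f y'" by blast
      show "x \<otimes>\<^bsub>B\<^esub> y \<in> carrier B"
        using x y by (simp add: closed mult_closed flip: hom(3))
      show "(r \<odot>\<^bsub>B\<^esub> x) \<otimes>\<^bsub>B\<^esub> y = r \<odot>\<^bsub>B\<^esub> (x \<otimes>\<^bsub>B\<^esub> y)"
        "x \<otimes>\<^bsub>B\<^esub> (r \<odot>\<^bsub>B\<^esub> y) = r \<odot>\<^bsub>B\<^esub> (x \<otimes>\<^bsub>B\<^esub> y)"
        using x y by (simp_all add: mult_smult_left mult_smult_right mult_closed flip: hom(2,3))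
    }
    show "\<one>\<^bsub>B\<^esub> \<in> carrier B" using closed[OF unit_closed] by (simp add: hom(4))
    {
      assume "x \<in> carrier B"
      from img[OF this] obtain x' where x: "x' \<in> carrier A" "x = f x'" by blast
      show "\<one>\<^bsub>B\<^esub> \<otimes>\<^bsub>B\<^esub> x = x" "x \<otimes>\<^bsub>B\<^esub> \<one>\<^bsub>B\<^esub> = x"
        using x by (simp_all add: unit_closed unit_left unit_right flip: hom(3,4))
    }
  qed
qed

end

section \<open>Square roots of minus one in the octonions\<close>

no_notation scalar_prod (infix "\<bullet>" 70)
notation octo_mult (infixl "\<star>" 70)

definition octo_one :: octo ("\<e>") where "\<e> = ((1, 0), (0, 0))"

lemma octo_mult_add_left: "(x + y) \<star> z = x \<star> z + y \<star> z"
  and octo_mult_add_right: "x \<star> (y + z) = x \<star> y + x \<star> z"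
  and octo_mult_scaleR_left: "(r *\<^sub>R x) \<star> y = r *\<^sub>R (x \<star> y)"
  and octo_mult_scaleR_right: "x \<star> (r *\<^sub>R y) = r *\<^sub>R (x \<star> y)"
  and octo_mult_one_left: "\<e> \<star> x = x"
  and octo_mult_one_right: "x \<star> \<e> = x"
proof -
  interpret nonassoc_algebra octonions by (rule nonassoc_algebra_octonions)
  show "(x + y) \<star> z = x \<star> z + y \<star> z" "x \<star> (y + z) = x \<star> y + x \<star> z"
    "(r *\<^sub>R x) \<star> y = r *\<^sub>R (x \<star> y)" "x \<star> (r *\<^sub>R y) = r *\<^sub>R (x \<star> y)"
    "\<e> \<star> x = x" "x \<star> \<e> = x"
    using mult_add_left[of x y z] mult_add_right[of x y z] mult_smult_left[of x y r]
      mult_smult_right[of x y r] unit_left[of x] unit_right[of x]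
    by (simp_all add: octonions_def octo_one_def)
qed

lemma bilinear_octo_mult: "bilinear (\<star>)"
  unfolding bilinear_def by (intro conjI allI linearI)
    (simp_all add: octo_mult_add_left octo_mult_add_right octo_mult_scaleR_left
      octo_mult_scaleR_right)

lemmas octo_mult_simps = octo_mult_add_left octo_mult_add_right octo_mult_scaleR_left
  octo_mult_scaleR_right bilinear_lsub[OF bilinear_octo_mult] bilinear_rsub[OF bilinear_octo_mult]
  bilinear_lneg[OF bilinear_octo_mult] bilinear_rneg[OF bilinear_octo_mult]
  bilinear_lzero[OF bilinear_octo_mult] bilinear_rzero[OF bilinear_octo_mult]
  octo_mult_one_left octo_mult_one_right

definition octo_cnj :: "octo \<Rightarrow> octo" where
  "octo_cnj x = (2 * (x \<bullet> \<e>)) *\<^sub>R \<e> - x"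

lemma inner_octo_one [simp]: "\<e> \<bullet> \<e> = 1"
  by (simp add: octo_one_def inner_prod_def)

lemma octo_cnj_cnj [simp]: "octo_cnj (octo_cnj x) = x"
  by (simp add: octo_cnj_def inner_diff_left)

lemma inner_octo_cnj [simp]: "octo_cnj x \<bullet> octo_cnj y = x \<bullet> y"
  by (simp add: octo_cnj_def inner_diff_left inner_diff_right inner_commute)

text \<open>All identities of this part come from multiplicativity of the norm. Polarizing
  \<open>\<bar>x y\<bar>\<^sup>2 = \<bar>x\<bar>\<^sup>2 \<bar>y\<bar>\<^sup>2\<close> in \<open>y\<close> gives the next lemma, and polarizing that
  in \<open>x\<close> gives the exchange law.\<close>

lemma inner_octo_mult_right: "(x \<star> y) \<bullet> (x \<star> z) = (x \<bullet> x) * (y \<bullet> z)"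
proof -
  have n: "(x \<star> y) \<bullet> (x \<star> y) = (x \<bullet> x) * (y \<bullet> y)" for y
    by (simp add: dot_square_norm norm_octo_mult power_mult_distrib)
  show ?thesis
    using n[of "y + z"] n[of y] n[of z]
    by (simp add: octo_mult_simps inner_add_left inner_add_right inner_commute algebra_simps)
qed

lemma inner_octo_mult_exchange:
  "(x \<star> y) \<bullet> (w \<star> z) + (w \<star> y) \<bullet> (x \<star> z) = 2 * (x \<bullet> w) * (y \<bullet> z)"
  using inner_octo_mult_right[of "x + w" y z] inner_octo_mult_right[of x y z]
    inner_octo_mult_right[of w y z]
  by (simp add: octo_mult_simps inner_add_left inner_add_right inner_commute algebra_simps)

text \<open>The exchange law with one of its arguments equal to the unit says that multiplication by the
  conjugate is adjoint to multiplication.\<close>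

lemma octo_cnj_adjoint_left: "(x \<star> y) \<bullet> z = y \<bullet> (octo_cnj x \<star> z)"
  using inner_octo_mult_exchange[of x y "\<e>" z]
  by (simp add: octo_cnj_def octo_mult_simps inner_diff_right)

lemma octo_cnj_adjoint_right: "(x \<star> y) \<bullet> z = x \<bullet> (z \<star> octo_cnj y)"
  using inner_octo_mult_exchange[of x y z "\<e>"]
  by (simp add: octo_cnj_def octo_mult_simps inner_diff_right inner_commute algebra_simps)

lemma octo_cnj_mult: "octo_cnj (x \<star> y) = octo_cnj y \<star> octo_cnj x"
proof (rule vector_eq_rdot[THEN iffD1], rule allI)
  fix z
  have "octo_cnj (x \<star> y) \<bullet> z = (x \<star> y) \<bullet> octo_cnj z"
    by (metis octo_cnj_cnj inner_octo_cnj)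
  also have "\<dots> = octo_cnj x \<bullet> (y \<star> z)"
    by (metis octo_cnj_adjoint_left octo_cnj_adjoint_right octo_cnj_cnj inner_commute)
  also have "\<dots> = (octo_cnj y \<star> octo_cnj x) \<bullet> z"
    by (metis octo_cnj_adjoint_left octo_cnj_cnj inner_commute)
  finally show "octo_cnj (x \<star> y) \<bullet> z = (octo_cnj y \<star> octo_cnj x) \<bullet> z" .
qed

text \<open>Moving one factor of the exchange law to the other side of the inner product removes the inner
  product altogether. For orthogonal \<open>x\<close> and \<open>w\<close> the right-hand side vanishes, and the identity
  replaces the missing associativity.\<close>

lemma octo_cnj_mult_exchange:
  "octo_cnj x \<star> (w \<star> y) + octo_cnj w \<star> (x \<star> y) = (2 * (x \<bullet> w)) *\<^sub>R y"
proof (rule vector_eq_rdot[THEN iffD1], rule allI)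
  fix z
  show "(octo_cnj x \<star> (w \<star> y) + octo_cnj w \<star> (x \<star> y)) \<bullet> z = ((2 * (x \<bullet> w)) *\<^sub>R y) \<bullet> z"
    using inner_octo_mult_exchange[of x y w z]
    by (simp add: inner_add_left octo_cnj_adjoint_left)
qed

lemma octo_cnj_mult_self: "octo_cnj x \<star> x = (x \<bullet> x) *\<^sub>R \<e>"
proof -
  have "2 *\<^sub>R (octo_cnj x \<star> x) = (2 * (x \<bullet> x)) *\<^sub>R \<e>"
    using octo_cnj_mult_exchange[of x x \<e>]
    unfolding scaleR_2[of "octo_cnj x \<star> x"] octo_mult_one_right .
  then have "2 *\<^sub>R (octo_cnj x \<star> x) = 2 *\<^sub>R ((x \<bullet> x) *\<^sub>R \<e>)"
    by (simp only: scaleR_scaleR)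
  then show ?thesis by (simp only: scaleR_cancel_left) simp
qed

lemma octo_mult_cnj_exchange:
  "(y \<star> w) \<star> octo_cnj x + (y \<star> x) \<star> octo_cnj w = (2 * (x \<bullet> w)) *\<^sub>R y"
proof (rule vector_eq_rdot[THEN iffD1], rule allI)
  fix z
  show "((y \<star> w) \<star> octo_cnj x + (y \<star> x) \<star> octo_cnj w) \<bullet> z = ((2 * (x \<bullet> w)) *\<^sub>R y) \<bullet> z"
    using inner_octo_mult_exchange[of y w z x]
    by (simp add: inner_add_left octo_cnj_adjoint_right[of "y \<star> w"]
      octo_cnj_adjoint_right[of "y \<star> x"] inner_commute[of "y \<star> x" "z \<star> w"])
      (simp add: inner_commute)
qed

lemma octo_mult_cnj_self: "(y \<star> x) \<star> octo_cnj x = (x \<bullet> x) *\<^sub>R y"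
proof -
  have "2 *\<^sub>R ((y \<star> x) \<star> octo_cnj x) = (2 * (x \<bullet> x)) *\<^sub>R y"
    using octo_mult_cnj_exchange[of y x x] unfolding scaleR_2[of "(y \<star> x) \<star> octo_cnj x"] .
  then have "2 *\<^sub>R ((y \<star> x) \<star> octo_cnj x) = 2 *\<^sub>R ((x \<bullet> x) *\<^sub>R y)"
    by (simp only: scaleR_scaleR)
  then show ?thesis by (simp only: scaleR_cancel_left) simp
qed

text \<open>Elements of a set \<open>S\<close> closed under products and conjugation and a unit vector \<open>z\<close> orthogonal to
  \<open>S\<close> multiply by the Cayley--Dickson formula, which is the one defining \<open>quat_mult\<close> and \<open>octo_mult\<close>. Beyond
  \<open>a c\<close>, the expanded product has three terms, and each is computed by an exchange law in which
  \<open>z\<close>, or \<open>b z\<close>, is orthogonal to the other exchanged element.\<close>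

lemma octo_doubling:
  assumes z: "z \<bullet> z = 1" and orth: "\<And>s. s \<in> S \<Longrightarrow> s \<bullet> z = 0"
    and one: "\<e> \<in> S" and cnj: "\<And>s. s \<in> S \<Longrightarrow> octo_cnj s \<in> S"
    and mult: "\<And>s t. s \<in> S \<Longrightarrow> t \<in> S \<Longrightarrow> s \<star> t \<in> S"
    and S: "a \<in> S" "b \<in> S" "c \<in> S" "d \<in> S"
  shows "(a + b \<star> z) \<star> (c + d \<star> z) =
    (a \<star> c - octo_cnj d \<star> b) + (d \<star> a + b \<star> octo_cnj c) \<star> z"
proof -
  have cz: "octo_cnj z = - z"
    using orth[OF one] by (simp add: octo_cnj_def inner_commute)
  have swap: "s \<star> z = z \<star> octo_cnj s" if "s \<in> S" for s
    using octo_cnj_mult_exchange[of "octo_cnj s" z \<e>] orth[OF cnj[OF that]] cz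
    by (simp add: octo_mult_simps)
  have left: "a \<star> (d \<star> z) = (d \<star> a) \<star> z"
  proof -
    have "a \<star> (z \<star> octo_cnj d) = z \<star> (octo_cnj a \<star> octo_cnj d)"
      using octo_cnj_mult_exchange[of "octo_cnj a" z "octo_cnj d"] orth[OF cnj[OF S(1)]] cz
      by (simp add: octo_mult_simps)
    then show ?thesis
      using S by (simp add: swap mult octo_cnj_mult)
  qed
  have right: "(b \<star> z) \<star> c = (b \<star> octo_cnj c) \<star> z"
    using octo_mult_cnj_exchange[of b z "octo_cnj c"] orth[OF cnj[OF S(3)]] cz
    by (simp add: octo_mult_simps)
  have both: "(b \<star> z) \<star> (d \<star> z) = - (octo_cnj d \<star> b)"
  proof -
    have orth': "(b \<star> z) \<bullet> s = 0" if "s \<in> S" for s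
      using orth[OF mult[OF cnj[OF S(2)] that]]
      by (metis octo_cnj_adjoint_left inner_commute)
    have "octo_cnj (b \<star> z) = - (b \<star> z)"
      using orth'[OF one] by (simp add: octo_cnj_def)
    moreover have "(b \<star> z) \<star> z = - b"
      using octo_mult_cnj_self[of b z] cz z by (simp add: octo_mult_simps minus_equation_iff)
    ultimately show ?thesis
      using octo_cnj_mult_exchange[of "b \<star> z" d z] orth'[OF S(4)]
      by (simp add: octo_mult_simps) (metis minus_minus)
  qed
  show ?thesis
    by (simp add: octo_mult_simps left right both algebra_simps)
qed

lemma unit_orthogonal_exists:
  fixes S :: "'a :: euclidean_space set"
  assumes "finite S" "card S < DIM('a)"
  obtains z where "z \<bullet> z = 1" "\<And>s. s \<in> S \<Longrightarrow> s \<bullet> z = 0"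
proof -
  have "dim S < DIM('a)" using assms dim_le_card'[of S] by linarith
  then obtain w where w: "w \<noteq> 0" "\<And>y. y \<in> span S \<Longrightarrow> orthogonal w y"
    using orthogonal_to_subspace_exists by blast
  show thesis
  proof
    show "sgn w \<bullet> sgn w = 1" using w by (simp add: dot_square_norm norm_sgn)
    show "s \<bullet> sgn w = 0" if "s \<in> S" for s
      using w(2)[OF span_base[OF that]] by (simp add: sgn_div_norm orthogonal_def inner_commute)
  qed
qed

text \<open>A square root of \<open>-1\<close> has norm one, so \<open>(2 \<langle>x, 1\<rangle> - x) x = 1\<close>; with \<open>x x = -1\<close> this
  becomes \<open>2 \<langle>x, 1\<rangle> x = 0\<close>.\<close>

lemma octo_sqrt_minus_one:
  assumes "x \<star> x = - \<e>"
  shows "x \<bullet> x = 1" "x \<bullet> \<e> = 0" "octo_cnj x = - x"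
proof -
  have "(x \<bullet> x) * (x \<bullet> x) = 1"
    using inner_octo_mult_right[of x x x] assms by simp
  then show xx: "x \<bullet> x = 1"
    using inner_ge_zero[of x] by (metis abs_of_nonneg abs_square_eq_1 power2_eq_square)
  have "octo_cnj x \<star> x = \<e>" using xx by (simp add: octo_cnj_mult_self)
  then have "(2 * (x \<bullet> \<e>)) *\<^sub>R x = 0"
    using assms by (simp add: octo_cnj_def octo_mult_simps)
  then show "x \<bullet> \<e> = 0" using xx by auto
  then show "octo_cnj x = - x" by (simp add: octo_cnj_def)
qed

text \<open>The automorphism group acts transitively on the square roots of \<open>-1\<close>. Starting from the copy
  of \<open>\<complex>\<close> generated by \<open>x\<close>, two doublings with unit vectors \<open>y\<close> and \<open>z\<close>, each orthogonal to what
  was built before, give homomorphisms \<open>\<phi>\<close>, \<open>\<psi>\<close>, \<open>\<Phi>\<close> from \<open>\<complex>\<close>, the quaternions and the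
  octonions. The last one is bijective because \<open>\<Phi> p = 0\<close> would give
  \<open>\<bar>p\<bar>\<^sup>2 = \<Phi> (p\<^sup>* p) = 0\<close>.\<close>

lemma octo_automorphism_exists:
  assumes x: "x \<star> x = - \<e>"
  obtains \<Phi> where "linear \<Phi>" "bij \<Phi>" "\<Phi> \<e> = \<e>" "\<Phi> ((\<i>, 0), 0) = x"
    "\<And>p q. \<Phi> (p \<star> q) = \<Phi> p \<star> \<Phi> q"
proof -
  note x_unit = octo_sqrt_minus_one[OF x]
  define \<phi> where "\<phi> a = Re a *\<^sub>R \<e> + Im a *\<^sub>R x" for a
  have \<phi>_lin: "\<phi> (a + b) = \<phi> a + \<phi> b" "\<phi> (a - b) = \<phi> a - \<phi> b" "\<phi> (- a) = - \<phi> a"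
    "\<phi> (r *\<^sub>R a) = r *\<^sub>R \<phi> a" for a b r
    by (simp_all add: \<phi>_def algebra_simps)
  have \<phi>_mult: "\<phi> (a * b) = \<phi> a \<star> \<phi> b" for a b
    by (simp add: \<phi>_def octo_mult_simps x algebra_simps)
  have \<phi>_cnj: "\<phi> (cnj a) = octo_cnj (\<phi> a)" for a
    using x_unit by (simp add: \<phi>_def octo_cnj_def inner_add_left algebra_simps flip: scaleR_add_left)
  have \<phi>_one: "\<phi> 1 = \<e>" by (simp add: \<phi>_def)

  have "card {\<e>, x} < DIM(octo)"
    using card_insert_le_m1[of 2 "{x}" \<e>] by (simp add: DIM_octo)
  then obtain y where y: "y \<bullet> y = 1" "\<And>s. s \<in> {\<e>, x} \<Longrightarrow> s \<bullet> y = 0"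
    using unit_orthogonal_exists[of "{\<e>, x}"] by blast
  have \<phi>_y: "\<phi> a \<bullet> y = 0" for a
    using y by (simp add: \<phi>_def inner_add_left)
  have double_y: "(\<phi> a + \<phi> b \<star> y) \<star> (\<phi> c + \<phi> d \<star> y) =
      (\<phi> a \<star> \<phi> c - octo_cnj (\<phi> d) \<star> \<phi> b) + (\<phi> d \<star> \<phi> a + \<phi> b \<star> octo_cnj (\<phi> c)) \<star> y"
    for a b c d
  proof (rule octo_doubling[OF y(1), where S = "range \<phi>"])
    show "s \<bullet> y = 0" if "s \<in> range \<phi>" for s using that \<phi>_y by blast
    show "\<e> \<in> range \<phi>" using \<phi>_one[symmetric] by simp
    show "octo_cnj s \<in> range \<phi>" if "s \<in> range \<phi>" for s
      using that by (auto simp flip: \<phi>_cnj)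
    show "s \<star> t \<in> range \<phi>" if "s \<in> range \<phi>" "t \<in> range \<phi>" for s t
      using that by (auto simp flip: \<phi>_mult)
  qed simp_all

  define \<psi> where "\<psi> p = \<phi> (fst p) + \<phi> (snd p) \<star> y" for p :: quat
  have \<psi>_lin: "\<psi> (p + q) = \<psi> p + \<psi> q" "\<psi> (p - q) = \<psi> p - \<psi> q"
    "\<psi> (r *\<^sub>R p) = r *\<^sub>R \<psi> p" for p q r
    by (simp_all add: \<psi>_def \<phi>_lin octo_mult_simps algebra_simps)
  have \<psi>_mult: "\<psi> (quat_mult p q) = \<psi> p \<star> \<psi> q" for p q
    by (cases p; cases q) (simp add: \<psi>_def double_y \<phi>_lin \<phi>_mult \<phi>_cnj)
  have \<psi>_cnj: "\<psi> (quat_cnj p) = octo_cnj (\<psi> p)" for p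
  proof (cases p)
    case (Pair a b)
    have "(\<phi> b \<star> y) \<bullet> \<e> = 0"
      using \<phi>_y[of "cnj b"]
      by (metis \<phi>_cnj octo_cnj_adjoint_left octo_mult_one_right inner_commute)
    then have "octo_cnj (\<phi> b \<star> y) = - (\<phi> b \<star> y)" by (simp add: octo_cnj_def)
    then show ?thesis
      by (simp add: Pair \<psi>_def \<phi>_cnj \<phi>_lin octo_mult_simps octo_cnj_def inner_add_left algebra_simps)
  qed
  have \<psi>_one: "\<psi> (1, 0) = \<e>" by (simp add: \<psi>_def \<phi>_one) (simp add: \<phi>_def octo_mult_simps)

  have "card {\<e>, x, y, x \<star> y} \<le> 4" by (simp add: card_insert_if)
  then have "card {\<e>, x, y, x \<star> y} < DIM(octo)" by (simp add: DIM_octo)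
  then obtain z where z: "z \<bullet> z = 1" "\<And>s. s \<in> {\<e>, x, y, x \<star> y} \<Longrightarrow> s \<bullet> z = 0"
    using unit_orthogonal_exists[of "{\<e>, x, y, x \<star> y}"] by blast
  have \<psi>_z: "\<psi> p \<bullet> z = 0" for p
    using z by (simp add: \<psi>_def \<phi>_def octo_mult_simps inner_add_left)
  have double_z: "(\<psi> a + \<psi> b \<star> z) \<star> (\<psi> c + \<psi> d \<star> z) =
      (\<psi> a \<star> \<psi> c - octo_cnj (\<psi> d) \<star> \<psi> b) + (\<psi> d \<star> \<psi> a + \<psi> b \<star> octo_cnj (\<psi> c)) \<star> z"
    for a b c d
  proof (rule octo_doubling[OF z(1), where S = "range \<psi>"])
    show "s \<bullet> z = 0" if "s \<in> range \<psi>" for s using that \<psi>_z by blast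
    show "\<e> \<in> range \<psi>" using \<psi>_one[symmetric] by simp
    show "octo_cnj s \<in> range \<psi>" if "s \<in> range \<psi>" for s
      using that by (auto simp flip: \<psi>_cnj)
    show "s \<star> t \<in> range \<psi>" if "s \<in> range \<psi>" "t \<in> range \<psi>" for s t
      using that by (auto simp flip: \<psi>_mult)
  qed simp_all

  define \<Phi> where "\<Phi> p = \<psi> (fst p) + \<psi> (snd p) \<star> z" for p :: octo
  have \<Phi>_mult: "\<Phi> (p \<star> q) = \<Phi> p \<star> \<Phi> q" for p q
    by (cases p; cases q)
      (simp only: \<Phi>_def octo_mult.simps fst_conv snd_conv double_z \<psi>_lin \<psi>_mult \<psi>_cnj)
  have \<psi>_zero: "\<psi> 0 = 0" by (simp add: \<psi>_def \<phi>_def octo_mult_simps)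
  have \<Phi>_one: "\<Phi> \<e> = \<e>"
  proof -
    have "\<Phi> \<e> = \<psi> (1, 0) + \<psi> 0 \<star> z"
      by (simp only: \<Phi>_def octo_one_def zero_prod_def fst_conv snd_conv)
    then show ?thesis by (simp only: \<psi>_one \<psi>_zero octo_mult_simps add_0_right)
  qed
  have \<Phi>_i: "\<Phi> ((\<i>, 0), 0) = x"
  proof -
    have "\<psi> (\<i>, 0) = x" by (simp add: \<psi>_def \<phi>_def octo_mult_simps)
    then show ?thesis
      by (simp only: \<Phi>_def fst_conv snd_conv \<psi>_zero octo_mult_simps add_0_right)
  qed
  have \<Phi>_linear: "linear \<Phi>"
    by (intro linearI) (simp_all add: \<Phi>_def \<psi>_lin octo_mult_simps algebra_simps)
  have "p = 0" if "\<Phi> p = 0" for p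
  proof -
    have "octo_cnj p \<star> p = (p \<bullet> p) *\<^sub>R \<e>" by (rule octo_cnj_mult_self)
    then have "(p \<bullet> p) *\<^sub>R \<e> = \<Phi> (octo_cnj p) \<star> \<Phi> p"
      by (metis \<Phi>_mult \<Phi>_one \<Phi>_linear linear_cmul)
    then have "(p \<bullet> p) *\<^sub>R \<e> = 0" by (simp only: that octo_mult_simps)
    then have "p \<bullet> p = 0" using inner_octo_one by (metis inner_zero_left scaleR_eq_0_iff zero_neq_one)
    then show ?thesis by (simp only: inner_eq_zero_iff)
  qed
  then have inj: "inj \<Phi>" using linear_injective_0[OF \<Phi>_linear] by blast
  then have "bij \<Phi>"
    using linear_injective_imp_surjective[OF \<Phi>_linear] by (simp add: bij_def)
  then show thesis using that \<Phi>_linear \<Phi>_one \<Phi>_i \<Phi>_mult by blast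
qed

section \<open>Unimodular coordinates\<close>

type_synonym c3 = "complex \<times> complex \<times> complex"

text \<open>Coordinates in which the inner product is the standard one and the volume form is the
  determinant. The structure \<open>V\<close> is not assumed to be a vector space, so that the locale can
  also serve to construct one.\<close>

locale unimodular_coordinates =
  fixes V :: "'v vol_space" (structure) and \<kappa> :: "c3 \<Rightarrow> 'v"
  assumes bij: "bij_betw \<kappa> UNIV (carrier V)"
    and zero: "\<kappa> 0 = \<zero>\<^bsub>V\<^esub>"
    and add: "\<kappa> (a + b) = \<kappa> a \<oplus>\<^bsub>V\<^esub> \<kappa> b"
    and smult: "\<kappa> (z * a1, z * a2, z * a3) = z \<odot>\<^bsub>V\<^esub> \<kappa> (a1, a2, a3)"
    and ip: "ip V (\<kappa> (a1, a2, a3)) (\<kappa> (b1, b2, b3)) = cnj a1 * b1 + cnj a2 * b2 + cnj a3 * b3"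
    and vol: "vol V (\<kappa> (a1, a2, a3)) (\<kappa> (b1, b2, b3)) (\<kappa> (c1, c2, c3)) =
      a1 * (b2 * c3 - b3 * c2) + a2 * (b3 * c1 - b1 * c3) + a3 * (b1 * c2 - b2 * c1)"
begin

lemma \<kappa>_closed: "\<kappa> a \<in> carrier V"
  using bij by (auto simp: bij_betw_def)

lemma \<kappa>_cases:
  assumes "x \<in> carrier V"
  obtains a1 a2 a3 where "x = \<kappa> (a1, a2, a3)"
proof -
  have "x \<in> range \<kappa>" using bij assms by (simp add: bij_betw_def)
  then show thesis using that by (metis imageE prod_cases3)
qed

lemma \<kappa>_inject: "\<kappa> a = \<kappa> b \<longleftrightarrow> a = b"
  using bij by (auto simp: bij_betw_def inj_eq)

text \<open>Both the inner product in its first argument and the cross product are conjugate linear, so the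
  usual formula for the cross product appears with all components conjugated.\<close>

lemma cross_\<kappa>:
  "cross V (\<kappa> (a1, a2, a3)) (\<kappa> (b1, b2, b3)) =
    \<kappa> (cnj (a2 * b3 - a3 * b2), cnj (a3 * b1 - a1 * b3), cnj (a1 * b2 - a2 * b1))"
  unfolding cross_def
proof (rule the_equality, intro conjI ballI \<kappa>_closed)
  fix c assume "c \<in> carrier V"
  then obtain c1 c2 c3 where c: "c = \<kappa> (c1, c2, c3)" by (rule \<kappa>_cases)
  show "ip V (\<kappa> (cnj (a2 * b3 - a3 * b2), cnj (a3 * b1 - a1 * b3), cnj (a1 * b2 - a2 * b1))) c =
      vol V (\<kappa> (a1, a2, a3)) (\<kappa> (b1, b2, b3)) c"
    by (simp add: c ip vol algebra_simps)
next
  fix v assume v: "v \<in> carrier V \<and>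
    (\<forall>c\<in>carrier V. ip V v c = vol V (\<kappa> (a1, a2, a3)) (\<kappa> (b1, b2, b3)) c)"
  obtain v1 v2 v3 where v': "v = \<kappa> (v1, v2, v3)" using v \<kappa>_cases by blast
  have "ip V v (\<kappa> c) = vol V (\<kappa> (a1, a2, a3)) (\<kappa> (b1, b2, b3)) (\<kappa> c)" for c
    using v \<kappa>_closed by blast
  from this[of "(1, 0, 0)"] this[of "(0, 1, 0)"] this[of "(0, 0, 1)"]
  have "cnj v1 = a2 * b3 - a3 * b2" "cnj v2 = a3 * b1 - a1 * b3" "cnj v3 = a1 * b2 - a2 * b1"
    by (simp_all add: v' ip vol)
  then show "v = \<kappa> (cnj (a2 * b3 - a3 * b2), cnj (a3 * b1 - a1 * b3), cnj (a1 * b2 - a2 * b1))"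
    unfolding v' by (metis complex_cnj_cnj)
qed

text \<open>Cross products are recognized by means of this lemma, as they are known through their inner
  products only.\<close>

lemma ip_nondegenerate:
  assumes "v \<in> carrier V" "w \<in> carrier V" and eq: "\<And>c. c \<in> carrier V \<Longrightarrow> ip V v c = ip V w c"
  shows "v = w"
proof -
  obtain v1 v2 v3 w1 w2 w3 where v: "v = \<kappa> (v1, v2, v3)" and w: "w = \<kappa> (w1, w2, w3)"
    using assms(1,2) \<kappa>_cases by metis
  from eq[OF \<kappa>_closed[of "(1, 0, 0)"]] eq[OF \<kappa>_closed[of "(0, 1, 0)"]] eq[OF \<kappa>_closed[of "(0, 0, 1)"]]
  show ?thesis by (simp add: v w ip)
qed

lemma
  assumes "a \<in> carrier V" "b \<in> carrier V"
  shows cross_closed: "cross V a b \<in> carrier V"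
    and ip_cross: "c \<in> carrier V \<Longrightarrow> ip V (cross V a b) c = vol V a b c"
proof -
  obtain a1 a2 a3 b1 b2 b3 where a: "a = \<kappa> (a1, a2, a3)" and b: "b = \<kappa> (b1, b2, b3)"
    using assms \<kappa>_cases by metis
  show "cross V a b \<in> carrier V" by (simp add: a b cross_\<kappa> \<kappa>_closed)
  assume "c \<in> carrier V"
  then obtain c1 c2 c3 where c: "c = \<kappa> (c1, c2, c3)" by (rule \<kappa>_cases)
  show "ip V (cross V a b) c = vol V a b c"
    by (simp add: a b c cross_\<kappa> ip vol algebra_simps)
qed

lemma O_obj_simps [simp]:
  "carrier (O_obj V) = UNIV \<times> carrier V" "\<one>\<^bsub>O_obj V\<^esub> = (1, \<zero>\<^bsub>V\<^esub>)" "\<zero>\<^bsub>O_obj V\<^esub> = (0, \<zero>\<^bsub>V\<^esub>)"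
  "root (O_obj V) = (\<i>, \<zero>\<^bsub>V\<^esub>)"
  "(\<alpha>, a) \<oplus>\<^bsub>O_obj V\<^esub> (\<beta>, b) = (\<alpha> + \<beta>, a \<oplus>\<^bsub>V\<^esub> b)"
  "r \<odot>\<^bsub>O_obj V\<^esub> (\<alpha>, a) = (of_real r * \<alpha>, of_real r \<odot>\<^bsub>V\<^esub> a)"
  by (simp_all add: O_obj_def)

lemma O_obj_mult: "(\<alpha>, a) \<otimes>\<^bsub>O_obj V\<^esub> (\<beta>, b) =
    (\<alpha> * \<beta> - ip V a b, cnj \<alpha> \<odot>\<^bsub>V\<^esub> b \<oplus>\<^bsub>V\<^esub> \<beta> \<odot>\<^bsub>V\<^esub> a \<oplus>\<^bsub>V\<^esub> cross V a b)"
  by (simp add: O_obj_def)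

lemma zero_closed: "\<zero>\<^bsub>V\<^esub> \<in> carrier V"
  using \<kappa>_closed[of 0] by (simp add: zero)

lemma smult_closed: "a \<in> carrier V \<Longrightarrow> z \<odot>\<^bsub>V\<^esub> a \<in> carrier V"
  by (metis \<kappa>_cases \<kappa>_closed smult)

lemma smult_zero_right: "z \<odot>\<^bsub>V\<^esub> \<zero>\<^bsub>V\<^esub> = \<zero>\<^bsub>V\<^esub>"
  using smult[of z 0 0 0] zero by (simp add: zero_prod_def)

lemma zero_laws:
  assumes "a \<in> carrier V"
  shows "\<zero>\<^bsub>V\<^esub> \<oplus>\<^bsub>V\<^esub> a = a" "a \<oplus>\<^bsub>V\<^esub> \<zero>\<^bsub>V\<^esub> = a" "0 \<odot>\<^bsub>V\<^esub> a = \<zero>\<^bsub>V\<^esub>"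
    "cross V a \<zero>\<^bsub>V\<^esub> = \<zero>\<^bsub>V\<^esub>" "cross V \<zero>\<^bsub>V\<^esub> a = \<zero>\<^bsub>V\<^esub>" "ip V a \<zero>\<^bsub>V\<^esub> = 0" "ip V \<zero>\<^bsub>V\<^esub> a = 0"
proof -
  obtain a1 a2 a3 where a: "a = \<kappa> (a1, a2, a3)" using assms by (rule \<kappa>_cases)
  have z: "\<zero>\<^bsub>V\<^esub> = \<kappa> (0, 0, 0)" using zero by (simp add: zero_prod_def)
  show "\<zero>\<^bsub>V\<^esub> \<oplus>\<^bsub>V\<^esub> a = a" "a \<oplus>\<^bsub>V\<^esub> \<zero>\<^bsub>V\<^esub> = a" "0 \<odot>\<^bsub>V\<^esub> a = \<zero>\<^bsub>V\<^esub>"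
    by (simp_all add: a z flip: add smult)
  show "cross V a \<zero>\<^bsub>V\<^esub> = \<zero>\<^bsub>V\<^esub>" "cross V \<zero>\<^bsub>V\<^esub> a = \<zero>\<^bsub>V\<^esub>" "ip V a \<zero>\<^bsub>V\<^esub> = 0" "ip V \<zero>\<^bsub>V\<^esub> a = 0"
    by (simp_all add: a z cross_\<kappa> ip)
qed

lemma O_obj_mult_vectors:
  assumes "a \<in> carrier V" "b \<in> carrier V"
  shows "(0, a) \<otimes>\<^bsub>O_obj V\<^esub> (0, b) = (- ip V a b, cross V a b)"
  using assms by (simp add: O_obj_mult zero_laws smult_zero_right zero_closed cross_closed)

lemma O_obj_mult_scalar_left:
  assumes "a \<in> carrier V"
  shows "(\<alpha>, \<zero>\<^bsub>V\<^esub>) \<otimes>\<^bsub>O_obj V\<^esub> (\<beta>, a) = (\<alpha> * \<beta>, cnj \<alpha> \<odot>\<^bsub>V\<^esub> a)"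
  using assms by (simp add: O_obj_mult zero_laws smult_zero_right zero_closed smult_closed)

lemma O_obj_mult_scalar_right:
  assumes "a \<in> carrier V"
  shows "(\<alpha>, a) \<otimes>\<^bsub>O_obj V\<^esub> (\<beta>, \<zero>\<^bsub>V\<^esub>) = (\<alpha> * \<beta>, \<beta> \<odot>\<^bsub>V\<^esub> a)"
  using assms by (simp add: O_obj_mult zero_laws smult_zero_right zero_closed smult_closed)

text \<open>Left multiplication by \<open>((\<i>, 0), 0)\<close> is multiplication by \<open>\<i>\<close> on the second and third complex
  component of an octonion and by \<open>-\<i>\<close> on the fourth, while \<open>(\<i>, 0)\<close> acts on all of \<open>V\<close> from the
  left by \<open>-\<i>\<close>. This is why exactly two components are conjugated; with these conjugations the
  components of the octonion product turn into those of the cross product.\<close>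

definition from_octonions :: "octo \<Rightarrow> complex \<times> 'v" where
  "from_octonions = (\<lambda>((\<alpha>, b), (c, d)). (\<alpha>, \<kappa> (cnj b, cnj c, d)))"

lemma from_octonions_iso: "from_octonions \<in> algebra_iso octonions (O_obj V)"
proof (rule algebra_isoI)
  have eq: "from_octonions = map_prod id \<kappa> \<circ> (\<lambda>((\<alpha>, b), (c, d)). (\<alpha>, cnj b, cnj c, d))"
    by (auto simp: from_octonions_def fun_eq_iff)
  have "bij (\<lambda>((\<alpha>, b), (c, d)). (\<alpha>, cnj b, cnj c, d))"
    by (rule bij_betwI[where g = "\<lambda>(\<alpha>, b, c, d). ((\<alpha>, cnj b), (cnj c, d))"]) auto
  moreover have "bij_betw (map_prod id \<kappa>) UNIV (UNIV \<times> carrier V)"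
    using bij_betw_map_prod[OF bij_id bij] by simp
  ultimately show "bij_betw from_octonions (carrier octonions) (carrier (O_obj V))"
    unfolding eq by (auto simp: octonions_def O_obj_def intro: bij_betw_trans)
next
  fix x y :: octo
  show "from_octonions (x \<oplus>\<^bsub>octonions\<^esub> y) = from_octonions x \<oplus>\<^bsub>O_obj V\<^esub> from_octonions y"
    by (auto simp: from_octonions_def octonions_def O_obj_def split: prod.splits simp flip: add)
next
  fix r and x :: octo
  show "from_octonions (r \<odot>\<^bsub>octonions\<^esub> x) = r \<odot>\<^bsub>O_obj V\<^esub> from_octonions x"
    by (auto simp: from_octonions_def octonions_def O_obj_def scaleR_conv_of_real
      split: prod.splits simp flip: smult)
next
  fix x y :: octo
  obtain a b c d where x: "x = ((a, b), (c, d))" by (metis surj_pair)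
  obtain a' b' c' d' where y: "y = ((a', b'), (c', d'))" by (metis surj_pair)
  show "from_octonions (x \<otimes>\<^bsub>octonions\<^esub> y) = from_octonions x \<otimes>\<^bsub>O_obj V\<^esub> from_octonions y"
    by (simp add: x y from_octonions_def octonions_def O_obj_def cross_\<kappa> ip \<kappa>_inject algebra_simps
      flip: smult add)
next
  show "from_octonions \<one>\<^bsub>octonions\<^esub> = \<one>\<^bsub>O_obj V\<^esub>"
    by (simp add: from_octonions_def octonions_def O_obj_def zero_prod_def flip: zero)
qed

lemma from_octonions_imaginary_unit: "from_octonions ((\<i>, 0), 0) = root (O_obj V)"
  by (simp add: from_octonions_def O_obj_def zero_prod_def flip: zero)

text \<open>Along \<^const>\<open>from_octonions\<close>, no axiom of an algebra has to be checked for the product on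
  \<open>\<complex> \<oplus> V\<close>.\<close>

lemma nonassoc_algebra_O_obj: "nonassoc_algebra (O_obj V)"
proof -
  interpret octonions: nonassoc_algebra octonions by (rule nonassoc_algebra_octonions)
  show ?thesis
    using from_octonions_iso
    by (rule octonions.transport_along_iso)
      (simp add: from_octonions_def octonions_def O_obj_def zero_prod_def flip: zero)
qed

lemma O_obj_in_octonion_objs: "O_obj V \<in> octonion_objs"
proof -
  interpret octonions: nonassoc_algebra octonions by (rule nonassoc_algebra_octonions)
  interpret O: nonassoc_algebra "O_obj V" by (rule nonassoc_algebra_O_obj)
  have "(\<ominus>\<^bsub>O_obj V\<^esub> \<one>\<^bsub>O_obj V\<^esub>) = (- 1, \<kappa> 0)"
  proof (rule O.M.minus_equality)
    show "(- 1, \<kappa> 0) \<oplus>\<^bsub>O_obj V\<^esub> \<one>\<^bsub>O_obj V\<^esub> = \<zero>\<^bsub>O_obj V\<^esub>"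
      by (simp add: O_obj_def flip: zero add)
    show "\<one>\<^bsub>O_obj V\<^esub> \<in> carrier (O_obj V)" by (rule O.unit_closed)
    show "(- 1, \<kappa> 0) \<in> carrier (O_obj V)" using \<kappa>_closed by (simp add: O_obj_def)
  qed
  moreover have "root (O_obj V) \<otimes>\<^bsub>O_obj V\<^esub> root (O_obj V) = (- 1, \<kappa> 0)"
    by (simp add: O_obj_def zero_prod_def ip cross_\<kappa> flip: zero smult add)
  moreover have "root (O_obj V) \<in> carrier (O_obj V)"
    using \<kappa>_closed by (simp add: O_obj_def flip: zero)
  ultimately show ?thesis
    using O.nonassoc_algebra_axioms octonions.algebra_iso_inverse[OF from_octonions_iso]
    by (auto simp: octonion_objs_def)
qed

end

section \<open>Orthonormal bases and the volume form\<close>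

definition (in inner_product_space) orthonormal :: "'v set \<Rightarrow> bool" where
  "orthonormal S \<longleftrightarrow> finite S \<and> S \<subseteq> carrier V \<and>
    (\<forall>a \<in> S. \<forall>b \<in> S. ip V a b = (if a = b then 1 else 0))"

context inner_product_space
begin

lemma ip_zero_right: "a \<in> carrier V \<Longrightarrow> ip V a \<zero>\<^bsub>V\<^esub> = 0"
  using ip_add[of a "\<zero>\<^bsub>V\<^esub>" "\<zero>\<^bsub>V\<^esub>"] by simp

lemma ip_add_left:
  "\<lbrakk>a \<in> carrier V; b \<in> carrier V; c \<in> carrier V\<rbrakk> \<Longrightarrow> ip V (a \<oplus>\<^bsub>V\<^esub> b) c = ip V a c + ip V b c"
  using ip_add[of c a b] by (metis M.a_closed complex_cnj_add ip_cnj)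

lemma ip_smult_left:
  "\<lbrakk>a \<in> carrier V; b \<in> carrier V\<rbrakk> \<Longrightarrow> ip V (z \<odot>\<^bsub>V\<^esub> a) b = cnj z * ip V a b"
  using ip_smult[of b a z] ip_cnj[of b "z \<odot>\<^bsub>V\<^esub> a"] ip_cnj[of b a] by simp

lemma ip_self_of_real: "a \<in> carrier V \<Longrightarrow> ip V a a = of_real (Re (ip V a a))"
  using ip_cnj[of a a] by (simp add: complex_eq_iff)

lemma ip_lincomb:
  assumes "finite A" "A \<subseteq> carrier V" "b \<in> carrier V"
  shows "ip V b (lincomb c A) = (\<Sum>a\<in>A. c a * ip V b a)"
  using assms(1,2)
proof (induction A rule: finite_induct)
  case empty
  then show ?case using assms(3) by (simp add: lincomb_def ip_zero_right)
next
  case (insert a A)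
  have "lincomb c (insert a A) = c a \<odot>\<^bsub>V\<^esub> a \<oplus>\<^bsub>V\<^esub> lincomb c A"
    unfolding lincomb_def using insert by (subst finsum_insert) auto
  moreover have "lincomb c A \<in> carrier V" using insert by (intro lincomb_closed) auto
  ultimately show ?case using insert assms(3) by (simp add: ip_add ip_smult)
qed

lemma ip_lincomb_orthonormal:
  assumes "orthonormal S" "s \<in> S"
  shows "ip V s (lincomb c S) = c s"
proof -
  have "ip V s (lincomb c S) = (\<Sum>a\<in>S. c a * ip V s a)"
    using assms by (intro ip_lincomb) (auto simp: orthonormal_def)
  also have "\<dots> = (\<Sum>a\<in>S. if a = s then c s else 0)"
    using assms by (intro sum.cong) (auto simp: orthonormal_def)
  finally show ?thesis using assms by (simp add: orthonormal_def)
qed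

lemma orthonormal_lin_indpt:
  assumes "orthonormal S"
  shows "lin_indpt S"
proof (rule finite_lin_indpt2)
  show "finite S" "S \<subseteq> carrier V" using assms by (auto simp: orthonormal_def)
  fix c assume "lincomb c S = \<zero>\<^bsub>V\<^esub>"
  then have "c s = 0" if "s \<in> S" for s
    using ip_lincomb_orthonormal[OF assms that, of c] that assms
    by (auto simp: orthonormal_def ip_zero_right)
  then show "\<forall>v\<in>S. c v = \<zero>\<^bsub>class_ring\<^esub>" by simp
qed

text \<open>One step of the Gram--Schmidt process, applied to a vector outside the span.\<close>

lemma orthonormal_extend:
  assumes S: "orthonormal S" and v: "v \<in> carrier V" "v \<notin> span S"
  shows "\<exists>u. u \<notin> S \<and> orthonormal (insert u S)"
proof -
  have fin: "finite S" and SV: "S \<subseteq> carrier V" using S by (auto simp: orthonormal_def)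
  define p where "p = lincomb (\<lambda>s. ip V s v) S"
  have p: "p \<in> carrier V" unfolding p_def using SV by (intro lincomb_closed) auto
  define w where "w = v \<oplus>\<^bsub>V\<^esub> (- 1) \<odot>\<^bsub>V\<^esub> p"
  have w: "w \<in> carrier V" using v p by (simp add: w_def)
  have orth: "ip V s w = 0" if "s \<in> S" for s
  proof -
    have "s \<in> carrier V" using that SV by blast
    then show ?thesis
      using ip_lincomb_orthonormal[OF S that, of "\<lambda>s. ip V s v"] v p
      by (simp add: w_def ip_add ip_smult p_def)
  qed
  have "w \<noteq> \<zero>\<^bsub>V\<^esub>"
  proof
    assume "w = \<zero>\<^bsub>V\<^esub>"
    moreover have "p \<oplus>\<^bsub>V\<^esub> (- 1) \<odot>\<^bsub>V\<^esub> p = \<zero>\<^bsub>V\<^esub>"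
      using smult_l_distr[of 1 "-1" p] p smult_l_null[of p] smult_one[of p] by simp
    ultimately have "v = p"
      using v p M.add.right_cancel[of "(- 1) \<odot>\<^bsub>V\<^esub> p" v p] unfolding w_def by simp
    then show False
      using v fin SV by (auto simp: p_def span_def)
  qed
  then have pos: "0 < Re (ip V w w)" using w by (intro ip_pos)
  define r where "r = sqrt (Re (ip V w w))"
  have r: "r > 0" "r * r = Re (ip V w w)" using pos by (simp_all add: r_def)
  define u where "u = of_real (1 / r) \<odot>\<^bsub>V\<^esub> w"
  have u: "u \<in> carrier V" using w by (simp add: u_def)
  have "ip V w w = of_real (r * r)" using r(2) ip_self_of_real[OF w] by simp
  then have "ip V u u = of_real (1 / r * (1 / r) * (r * r))"
    using w by (simp add: u_def ip_smult ip_smult_left)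
  then have uu: "ip V u u = 1" using r(1) by simp
  have su: "ip V s u = 0" if "s \<in> S" for s
    using orth[OF that] that SV w by (simp add: u_def ip_smult subset_iff)
  have us: "ip V u s = 0" if "s \<in> S" for s
    using su[OF that] ip_cnj[of s u] that SV u by (simp add: subset_iff)
  have "u \<notin> S" using su uu by force
  then show ?thesis
    using S u uu su us by (intro exI[of _ u]) (auto simp: orthonormal_def)
qed

lemma orthonormal_exists:
  assumes "fin_dim" "n \<le> dim"
  shows "\<exists>S. orthonormal S \<and> card S = n"
  using assms(2)
proof (induction n)
  case 0
  show ?case by (intro exI[of _ "{}"]) (simp add: orthonormal_def)
next
  case (Suc n)
  then obtain S where S: "orthonormal S" "card S = n" by auto
  then have "finite S" "S \<subseteq> carrier V" by (auto simp: orthonormal_def)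
  then have "span S \<noteq> carrier V" using gen_ge_dim[of S] S Suc.prems by auto
  then obtain v where "v \<in> carrier V" "v \<notin> span S"
    using span_is_subset2[OF \<open>S \<subseteq> carrier V\<close>] by blast
  with orthonormal_extend[OF S(1)] obtain u where "u \<notin> S" "orthonormal (insert u S)" by blast
  then show ?case using S \<open>finite S\<close> by (intro exI[of _ "insert u S"]) simp
qed

end

lemma alt_form3_swap:
  assumes \<mu>: "alt_form3 V \<mu>" and V: "abelian_group V"
    and a: "a \<in> carrier V" and b: "b \<in> carrier V" and c: "c \<in> carrier V"
  shows "\<mu> b a c = - \<mu> a b c" "\<mu> a c b = - \<mu> a b c"
proof -
  interpret abelian_group V by (rule V)
  note lin = \<mu>[unfolded alt_form3_def, THEN conjunct1, rule_format]
    and alt = \<mu>[unfolded alt_form3_def, THEN conjunct2, THEN conjunct2, rule_format]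
  have *: "\<mu> (a \<oplus>\<^bsub>V\<^esub> b) (a \<oplus>\<^bsub>V\<^esub> b) c = 0" "\<mu> a (b \<oplus>\<^bsub>V\<^esub> c) (b \<oplus>\<^bsub>V\<^esub> c) = 0"
    using alt a b c by auto
  have "\<mu> (a \<oplus>\<^bsub>V\<^esub> b) (a \<oplus>\<^bsub>V\<^esub> b) c = \<mu> a b c + \<mu> b a c"
    using lin[of a "a \<oplus>\<^bsub>V\<^esub> b" c b] lin[of a a c b] lin[of b a c b] alt a b c by simp
  moreover have "\<mu> a (b \<oplus>\<^bsub>V\<^esub> c) (b \<oplus>\<^bsub>V\<^esub> c) = \<mu> a b c + \<mu> a c b"
    using lin[of a b "b \<oplus>\<^bsub>V\<^esub> c" c] lin[of a b b c] lin[of a c b c] alt a b c by simp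
  ultimately show "\<mu> b a c = - \<mu> a b c" "\<mu> a c b = - \<mu> a b c"
    using * by (simp_all add: eq_neg_iff_add_eq_0 add.commute)
qed

context volume_space
begin

lemma vol_add:
  assumes "a \<in> carrier V" "b \<in> carrier V" "c \<in> carrier V" "d \<in> carrier V"
  shows "vol V (a \<oplus>\<^bsub>V\<^esub> d) b c = vol V a b c + vol V d b c"
    "vol V a (b \<oplus>\<^bsub>V\<^esub> d) c = vol V a b c + vol V a d c"
    "vol V a b (c \<oplus>\<^bsub>V\<^esub> d) = vol V a b c + vol V a b d"
  using vol_alt assms by (auto simp: alt_form3_def)

lemma vol_smult:
  assumes "a \<in> carrier V" "b \<in> carrier V" "c \<in> carrier V"
  shows "vol V (z \<odot>\<^bsub>V\<^esub> a) b c = z * vol V a b c" "vol V a (z \<odot>\<^bsub>V\<^esub> b) c = z * vol V a b c"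
    "vol V a b (z \<odot>\<^bsub>V\<^esub> c) = z * vol V a b c"
  using vol_alt assms by (auto simp: alt_form3_def)

lemma vol_repeat:
  assumes "a \<in> carrier V" "b \<in> carrier V"
  shows "vol V a a b = 0" "vol V a b a = 0" "vol V b a a = 0"
  using vol_alt assms by (auto simp: alt_form3_def)

lemma vol_permute:
  assumes a: "a \<in> carrier V" and b: "b \<in> carrier V" and c: "c \<in> carrier V"
  shows "vol V b a c = - vol V a b c" "vol V a c b = - vol V a b c" "vol V b c a = vol V a b c"
    "vol V c a b = vol V a b c" "vol V c b a = - vol V a b c"
proof -
  note swap = alt_form3_swap[OF vol_alt M.abelian_group_axioms]
  show 1: "vol V b a c = - vol V a b c" and 2: "vol V a c b = - vol V a b c"
    using swap[OF a b c] by auto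
  show 3: "vol V b c a = vol V a b c" using swap(2)[OF b a c] 1 by simp
  show "vol V c a b = vol V a b c" using swap(1)[OF a c b] 2 by simp
  show "vol V c b a = - vol V a b c" using swap(1)[OF b c a] 3 by simp
qed

text \<open>In three dimensions a normalized volume form takes a value \<open>w\<close> with \<open>\<bar>w\<bar> = 1\<close> on every
  orthonormal basis, because the six orderings of the basis all contribute \<open>\<bar>w\<bar>\<^sup>2\<close> to the norm
  of the form. Multiplying the last basis vector by \<open>cnj w\<close> changes the value to \<open>1\<close> and keeps the
  basis orthonormal.\<close>

lemma unimodular_frame_exists:
  obtains e1 e2 e3 where "orthonormal {e1, e2, e3}" "e1 \<noteq> e2" "e1 \<noteq> e3" "e2 \<noteq> e3"
    "vol V e1 e2 e3 = 1"
proof -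
  obtain S where S: "orthonormal S" "card S = 3"
    using orthonormal_exists[OF fin_dim, of 3] dim_3 by auto
  then obtain e1 e2 e3 where e: "S = {e1, e2, e3}" "e1 \<noteq> e2" "e1 \<noteq> e3" "e2 \<noteq> e3"
    by (auto simp: card_3_iff)
  then have eV: "e1 \<in> carrier V" "e2 \<in> carrier V" "e3 \<in> carrier V"
    using S by (auto simp: orthonormal_def)
  have "basis S"
    using S dim_3 by (intro dim_li_is_basis fin_dim orthonormal_lin_indpt) (auto simp: orthonormal_def)
  then have onb: "orthonormal_basis V S"
    using S by (simp add: orthonormal_basis_def orthonormal_def)
  define w where "w = vol V e1 e2 e3"
  have vals: "vol V e2 e1 e3 = - w" "vol V e1 e3 e2 = - w" "vol V e3 e1 e2 = w"
    "vol V e2 e3 e1 = w" "vol V e3 e2 e1 = - w"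
    using vol_permute[OF eV] by (simp_all add: w_def)
  have "(\<Sum>a\<in>S. \<Sum>b\<in>S. \<Sum>c\<in>S. cnj (vol V a b c) * vol V a b c) = 6 * (cnj w * w)"
    using e eV by (simp add: vals w_def[symmetric] vol_repeat)
  then have w: "cnj w * w = 1"
    using form3_ip_eq[OF fin_dim vol_alt vol_alt onb] vol_normalized by simp
  define e3' where "e3' = cnj w \<odot>\<^bsub>V\<^esub> e3"
  have on: "ip V e1 e1 = 1" "ip V e2 e2 = 1" "ip V e3 e3 = 1" "ip V e1 e2 = 0" "ip V e2 e1 = 0"
    "ip V e1 e3 = 0" "ip V e3 e1 = 0" "ip V e2 e3 = 0" "ip V e3 e2 = 0"
    using S e by (auto simp: orthonormal_def)
  have ip': "ip V e3' e3' = 1" "ip V e1 e3' = 0" "ip V e3' e1 = 0" "ip V e2 e3' = 0"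
    "ip V e3' e2 = 0"
    using eV w on by (simp_all add: e3'_def ip_smult ip_smult_left mult.commute)
  have eV': "e3' \<in> carrier V" using eV by (simp add: e3'_def)
  have "e1 \<noteq> e3'" "e2 \<noteq> e3'" using ip' on by auto
  moreover have "orthonormal {e1, e2, e3'}"
    using ip' on eV eV' by (auto simp: orthonormal_def)
  moreover have "vol V e1 e2 e3' = 1"
    using eV w by (simp add: e3'_def vol_smult w_def)
  ultimately show thesis using that e(2) by blast
qed

lemma unimodular_coordinates_exist: "\<exists>\<kappa>. unimodular_coordinates V \<kappa>"
proof -
  obtain e1 e2 e3 where on: "orthonormal {e1, e2, e3}" and ne: "e1 \<noteq> e2" "e1 \<noteq> e3" "e2 \<noteq> e3"
    and v: "vol V e1 e2 e3 = 1"
    by (rule unimodular_frame_exists)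
  have eV [simp]: "e1 \<in> carrier V" "e2 \<in> carrier V" "e3 \<in> carrier V"
    using on by (auto simp: orthonormal_def)
  have ips: "ip V e1 e1 = 1" "ip V e2 e2 = 1" "ip V e3 e3 = 1" "ip V e1 e2 = 0" "ip V e2 e1 = 0"
    "ip V e1 e3 = 0" "ip V e3 e1 = 0" "ip V e2 e3 = 0" "ip V e3 e2 = 0"
    using on ne by (auto simp: orthonormal_def)
  have vols: "vol V e2 e1 e3 = - 1" "vol V e1 e3 e2 = - 1" "vol V e3 e1 e2 = 1"
    "vol V e2 e3 e1 = 1" "vol V e3 e2 e1 = - 1"
    using vol_permute[OF eV] v by simp_all
  have gen: "span {e1, e2, e3} = carrier V"
    using dim_li_is_basis[OF fin_dim, of "{e1, e2, e3}"] orthonormal_lin_indpt[OF on] ne dim_3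
    by (simp add: basis_def)
  define \<kappa> where "\<kappa> = (\<lambda>(a1, a2, a3). a1 \<odot>\<^bsub>V\<^esub> e1 \<oplus>\<^bsub>V\<^esub> (a2 \<odot>\<^bsub>V\<^esub> e2 \<oplus>\<^bsub>V\<^esub> a3 \<odot>\<^bsub>V\<^esub> e3))"
  have \<kappa>V: "\<kappa> a \<in> carrier V" for a by (cases a) (simp add: \<kappa>_def)
  have \<kappa>_ip: "ip V e1 (\<kappa> (a1, a2, a3)) = a1" "ip V e2 (\<kappa> (a1, a2, a3)) = a2"
    "ip V e3 (\<kappa> (a1, a2, a3)) = a3" for a1 a2 a3
    by (simp_all add: \<kappa>_def ip_add ip_smult ips)
  have "bij_betw \<kappa> UNIV (carrier V)"
    unfolding bij_betw_def
  proof
    show "inj \<kappa>"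
      by (rule injI) (metis \<kappa>_ip prod_cases3)
    show "range \<kappa> = carrier V"
    proof
      show "range \<kappa> \<subseteq> carrier V" using \<kappa>V by auto
      show "carrier V \<subseteq> range \<kappa>"
      proof
        fix x assume "x \<in> carrier V"
        then obtain c where "x = lincomb c {e1, e2, e3}"
          using finite_span[of "{e1, e2, e3}"] gen by auto
        then have "x = \<kappa> (c e1, c e2, c e3)"
          using ne by (simp add: lincomb_def \<kappa>_def)
        then show "x \<in> range \<kappa>" by blast
      qed
    qed
  qed
  moreover have "\<kappa> 0 = \<zero>\<^bsub>V\<^esub>"
    using smult_l_null[OF eV(1)] smult_l_null[OF eV(2)] smult_l_null[OF eV(3)]
    by (simp add: \<kappa>_def zero_prod_def)
  moreover have "\<kappa> (a + b) = \<kappa> a \<oplus>\<^bsub>V\<^esub> \<kappa> b" for a b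
    by (cases a; cases b) (simp add: \<kappa>_def smult_l_distr[simplified] M.a_ac)
  moreover have "\<kappa> (z * a1, z * a2, z * a3) = z \<odot>\<^bsub>V\<^esub> \<kappa> (a1, a2, a3)" for z a1 a2 a3
    by (simp add: \<kappa>_def smult_r_distr smult_assoc1[simplified])
  moreover have "ip V (\<kappa> (a1, a2, a3)) (\<kappa> (b1, b2, b3)) = cnj a1 * b1 + cnj a2 * b2 + cnj a3 * b3"
    for a1 a2 a3 b1 b2 b3
    by (simp add: \<kappa>_def ip_add ip_smult ip_add_left ip_smult_left ips)
  moreover have "vol V (\<kappa> (a1, a2, a3)) (\<kappa> (b1, b2, b3)) (\<kappa> (c1, c2, c3)) =
      a1 * (b2 * c3 - b3 * c2) + a2 * (b3 * c1 - b1 * c3) + a3 * (b1 * c2 - b2 * c1)"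
    for a1 a2 a3 b1 b2 b3 c1 c2 c3
    by (simp add: \<kappa>_def vol_add vol_smult vol_repeat vols v) (simp add: algebra_simps)
  ultimately show ?thesis by (intro exI[of _ \<kappa>] unimodular_coordinates.intro)
qed

end

context unimodular_coordinates
begin

lemma volume_space: "volume_space V"
proof -
  have "module class_ring V"
  proof (intro Module.moduleI class_cring.cring_axioms abelian_groupI)
    show "\<zero>\<^bsub>V\<^esub> \<in> carrier V" using \<kappa>_closed[of 0] by (simp add: zero)
    fix x y z assume x: "x \<in> carrier V"
    obtain x1 x2 x3 where x': "x = \<kappa> (x1, x2, x3)" using x by (rule \<kappa>_cases)
    show "\<zero>\<^bsub>V\<^esub> \<oplus>\<^bsub>V\<^esub> x = x" by (simp add: x' flip: zero add)
    show "\<exists>y\<in>carrier V. y \<oplus>\<^bsub>V\<^esub> x = \<zero>\<^bsub>V\<^esub>"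
      by (rule bexI[of _ "\<kappa> (- (x1, x2, x3))"])
        (simp_all add: x' \<kappa>_closed zero_prod_def flip: zero add)
    show "a \<odot>\<^bsub>V\<^esub> x \<in> carrier V" for a :: complex by (simp add: x' \<kappa>_closed flip: smult)
    show "(a \<oplus>\<^bsub>class_ring\<^esub> b) \<odot>\<^bsub>V\<^esub> x = a \<odot>\<^bsub>V\<^esub> x \<oplus>\<^bsub>V\<^esub> b \<odot>\<^bsub>V\<^esub> x" for a b :: complex
      by (simp add: x' algebra_simps flip: smult add)
    show "(a \<otimes>\<^bsub>class_ring\<^esub> b) \<odot>\<^bsub>V\<^esub> x = a \<odot>\<^bsub>V\<^esub> (b \<odot>\<^bsub>V\<^esub> x)" for a b :: complex
      by (simp add: x' algebra_simps flip: smult)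
    show "\<one>\<^bsub>class_ring\<^esub> \<odot>\<^bsub>V\<^esub> x = x" by (simp add: x' flip: smult)
    assume y: "y \<in> carrier V"
    obtain y1 y2 y3 where y': "y = \<kappa> (y1, y2, y3)" using y by (rule \<kappa>_cases)
    show "x \<oplus>\<^bsub>V\<^esub> y \<in> carrier V" by (simp add: x' y' \<kappa>_closed flip: add)
    show "x \<oplus>\<^bsub>V\<^esub> y = y \<oplus>\<^bsub>V\<^esub> x" by (simp add: x' y' add.commute flip: add)
    show "a \<odot>\<^bsub>V\<^esub> (x \<oplus>\<^bsub>V\<^esub> y) = a \<odot>\<^bsub>V\<^esub> x \<oplus>\<^bsub>V\<^esub> a \<odot>\<^bsub>V\<^esub> y" for a :: complex
      by (simp add: x' y' algebra_simps flip: smult add)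
    assume z: "z \<in> carrier V"
    obtain z1 z2 z3 where z': "z = \<kappa> (z1, z2, z3)" using z by (rule \<kappa>_cases)
    show "x \<oplus>\<^bsub>V\<^esub> y \<oplus>\<^bsub>V\<^esub> z = x \<oplus>\<^bsub>V\<^esub> (y \<oplus>\<^bsub>V\<^esub> z)"
      by (simp add: x' y' z' add.assoc flip: add)
  qed
  then interpret vectorspace "class_ring :: complex ring" V
    by (simp add: vectorspace_def class_field.field_axioms)
  interpret inner_product_space V
  proof
    fix a b c z assume a: "a \<in> carrier V"
    obtain a1 a2 a3 where a': "a = \<kappa> (a1, a2, a3)" using a by (rule \<kappa>_cases)
    show "0 < Re (ip V a a)" if nz: "a \<noteq> \<zero>\<^bsub>V\<^esub>"
    proof -
      have "a1 \<noteq> 0 \<or> a2 \<noteq> 0 \<or> a3 \<noteq> 0" using nz zero by (auto simp: a' zero_prod_def)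
      then have "0 < (cmod a1)\<^sup>2 + (cmod a2)\<^sup>2 + (cmod a3)\<^sup>2"
        by (smt (verit) zero_le_power2 zero_less_norm_iff zero_less_power)
      then show ?thesis by (simp add: a' ip cmod_power2) (simp add: power2_eq_square)
    qed
    assume b: "b \<in> carrier V"
    obtain b1 b2 b3 where b': "b = \<kappa> (b1, b2, b3)" using b by (rule \<kappa>_cases)
    show "ip V a (z \<odot>\<^bsub>V\<^esub> b) = z * ip V a b" by (simp add: a' b' ip algebra_simps flip: smult)
    show "ip V b a = cnj (ip V a b)" by (simp add: a' b' ip)
    assume c: "c \<in> carrier V"
    obtain c1 c2 c3 where c': "c = \<kappa> (c1, c2, c3)" using c by (rule \<kappa>_cases)
    show "ip V a (b \<oplus>\<^bsub>V\<^esub> c) = ip V a b + ip V a c"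
      by (simp add: a' b' c' ip algebra_simps flip: add)
  qed
  define e1 e2 e3 where e: "e1 = \<kappa> (1, 0, 0)" "e2 = \<kappa> (0, 1, 0)" "e3 = \<kappa> (0, 0, 1)"
  have ne: "e1 \<noteq> e2" "e1 \<noteq> e3" "e2 \<noteq> e3" by (simp_all add: e \<kappa>_inject)
  have eV: "e1 \<in> carrier V" "e2 \<in> carrier V" "e3 \<in> carrier V" by (simp_all add: e \<kappa>_closed)
  have on: "orthonormal {e1, e2, e3}"
    by (auto simp: orthonormal_def e ip \<kappa>_closed \<kappa>_inject)
  have gen: "span {e1, e2, e3} = carrier V"
  proof
    show "span {e1, e2, e3} \<subseteq> carrier V" using eV by (intro span_is_subset2) auto
    show "carrier V \<subseteq> span {e1, e2, e3}"
    proof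
      fix x assume "x \<in> carrier V"
      then obtain x1 x2 x3 where x: "x = \<kappa> (x1, x2, x3)" by (rule \<kappa>_cases)
      have "lincomb (\<lambda>v. if v = e1 then x1 else if v = e2 then x2 else x3) {e1, e2, e3} = x"
        using ne eV by (simp add: lincomb_def) (simp add: x e flip: smult add)
      then show "x \<in> span {e1, e2, e3}"
        unfolding span_def by (intro CollectI exI[of _ "{e1, e2, e3}"] exI) auto
    qed
  qed
  have bas: "basis {e1, e2, e3}"
    using gen eV orthonormal_lin_indpt[OF on] by (simp add: basis_def)
  have fd: "fin_dim"
    unfolding fin_dim_def using gen eV by (intro exI[of _ "{e1, e2, e3}"]) simp
  have alt: "alt_form3 V (vol V)"
    unfolding alt_form3_def
  proof (intro conjI allI ballI)
    fix z a b c d assume a: "a \<in> carrier V" and b: "b \<in> carrier V"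
    obtain a1 a2 a3 b1 b2 b3 where ab: "a = \<kappa> (a1, a2, a3)" "b = \<kappa> (b1, b2, b3)"
      using a b \<kappa>_cases by metis
    show "vol V a a b = 0" "vol V a b a = 0" "vol V b a a = 0"
      by (simp_all add: ab vol algebra_simps)
    assume c: "c \<in> carrier V"
    obtain c1 c2 c3 where c': "c = \<kappa> (c1, c2, c3)" using c by (rule \<kappa>_cases)
    show "vol V (z \<odot>\<^bsub>V\<^esub> a) b c = z * vol V a b c" "vol V a (z \<odot>\<^bsub>V\<^esub> b) c = z * vol V a b c"
      "vol V a b (z \<odot>\<^bsub>V\<^esub> c) = z * vol V a b c"
      by (simp_all add: ab c' vol algebra_simps flip: smult)
    assume d: "d \<in> carrier V"
    obtain d1 d2 d3 where d': "d = \<kappa> (d1, d2, d3)" using d by (rule \<kappa>_cases)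
    show "vol V (a \<oplus>\<^bsub>V\<^esub> d) b c = vol V a b c + vol V d b c"
      "vol V a (b \<oplus>\<^bsub>V\<^esub> d) c = vol V a b c + vol V a d c"
      "vol V a b (c \<oplus>\<^bsub>V\<^esub> d) = vol V a b c + vol V a b d"
      by (simp_all add: ab c' d' vol algebra_simps flip: add)
  qed
  have onb: "orthonormal_basis V {e1, e2, e3}"
    using bas on by (simp add: orthonormal_basis_def orthonormal_def)
  have "form3_ip V (vol V) (vol V) = 1"
    unfolding form3_ip_eq[OF fd alt alt onb] using ne by (simp add: e vol)
  moreover have "dim = 3" using dim_basis[OF _ bas] ne by simp
  ultimately show ?thesis using fd alt by unfold_locales
qed

end

text \<open>Transport of the standard structure on \<open>\<complex>\<^sup>3\<close> along an injection; the fields \<open>mult\<close> and \<open>one\<close>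
  get arbitrary values.\<close>

lemma unimodular_coordinates_realized:
  fixes j :: "c3 \<Rightarrow> 'v"
  assumes j: "inj j"
  shows "\<exists>V. unimodular_coordinates V j"
proof -
  let ?i = "inv_into UNIV j"
  let ?V = "\<lparr>carrier = range j, mult = (\<lambda>x y. x), one = j 0, zero = j 0,
    add = (\<lambda>x y. j (?i x + ?i y)),
    smult = (\<lambda>z x. case ?i x of (x1, x2, x3) \<Rightarrow> j (z * x1, z * x2, z * x3)),
    ip = (\<lambda>x y. case ?i x of (x1, x2, x3) \<Rightarrow> case ?i y of (y1, y2, y3) \<Rightarrow>
      cnj x1 * y1 + cnj x2 * y2 + cnj x3 * y3),
    vol = (\<lambda>x y z. case ?i x of (x1, x2, x3) \<Rightarrow> case ?i y of (y1, y2, y3) \<Rightarrow>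
      case ?i z of (z1, z2, z3) \<Rightarrow>
        x1 * (y2 * z3 - y3 * z2) + x2 * (y3 * z1 - y1 * z3) + x3 * (y1 * z2 - y2 * z1))\<rparr>"
  have "unimodular_coordinates ?V j"
    using j by unfold_locales (simp_all add: bij_betw_def)
  then show ?thesis by blast
qed

text \<open>The six real coordinates of a point of \<open>\<complex>\<^sup>3\<close> are packed into one real number, since
  \<open>\<real> \<times> \<real>\<close> and \<open>\<real>\<close> have the same cardinality.\<close>

lemma complex_3_space_embeds:
  assumes "inj (emb :: real \<Rightarrow> 'v)"
  shows "\<exists>j :: c3 \<Rightarrow> 'v. inj j"
proof -
  obtain pair :: "real \<times> real \<Rightarrow> real" where "bij_betw pair (UNIV \<times> UNIV) UNIV"
    using card_of_Times_same_infinite[OF infinite_UNIV_char_0[where 'a = real]]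
    unfolding card_of_ordIso[symmetric] by blast
  then have pair: "pair p = pair q \<longleftrightarrow> p = q" for p q
    by (auto simp: bij_betw_def inj_eq)
  have "inj (\<lambda>(a, b, c). emb (pair (pair (Re a, Im a), pair (pair (Re b, Im b), pair (Re c, Im c)))))"
    by (auto intro!: injI simp: inj_eq[OF assms] pair complex_eq_iff)
  then show ?thesis by blast
qed

section \<open>The functor is fully faithful\<close>

lemma unitary_volD:
  assumes "f \<in> unitary_vol V W"
  shows "a \<in> carrier V \<Longrightarrow> f a \<in> carrier W"
    and "a \<in> carrier V \<Longrightarrow> b \<in> carrier V \<Longrightarrow> f (a \<oplus>\<^bsub>V\<^esub> b) = f a \<oplus>\<^bsub>W\<^esub> f b"
    and "a \<in> carrier V \<Longrightarrow> f (z \<odot>\<^bsub>V\<^esub> a) = z \<odot>\<^bsub>W\<^esub> f a"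
    and "a \<in> carrier V \<Longrightarrow> b \<in> carrier V \<Longrightarrow> ip W (f a) (f b) = ip V a b"
    and "a \<in> carrier V \<Longrightarrow> b \<in> carrier V \<Longrightarrow> c \<in> carrier V \<Longrightarrow>
      vol W (f a) (f b) (f c) = vol V a b c"
    and "bij_betw f (carrier V) (carrier W)" "f \<in> extensional (carrier V)"
  using assms by (auto simp: unitary_vol_def module_hom_def)

lemma unitary_volI:
  assumes "bij_betw f (carrier V) (carrier W)" "f \<in> extensional (carrier V)"
    and "\<And>a b. a \<in> carrier V \<Longrightarrow> b \<in> carrier V \<Longrightarrow> f (a \<oplus>\<^bsub>V\<^esub> b) = f a \<oplus>\<^bsub>W\<^esub> f b"
    and "\<And>z a. a \<in> carrier V \<Longrightarrow> f (z \<odot>\<^bsub>V\<^esub> a) = z \<odot>\<^bsub>W\<^esub> f a"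
    and "\<And>a b. a \<in> carrier V \<Longrightarrow> b \<in> carrier V \<Longrightarrow> ip W (f a) (f b) = ip V a b"
    and "\<And>a b c. a \<in> carrier V \<Longrightarrow> b \<in> carrier V \<Longrightarrow> c \<in> carrier V \<Longrightarrow>
      vol W (f a) (f b) (f c) = vol V a b c"
  shows "f \<in> unitary_vol V W"
  using assms bij_betwE[OF assms(1)] by (auto simp: unitary_vol_def module_hom_def)

lemma rooted_isoD:
  assumes "f \<in> rooted_iso A B"
  shows "f \<in> algebra_iso A B" "f \<in> extensional (carrier A)" "f (root A) = root B"
  using assms by (auto simp: rooted_iso_def)

locale two_unimodular_coordinates =
  V: unimodular_coordinates V \<kappa> + W: unimodular_coordinates W \<kappa>'
  for V :: "'v vol_space" and \<kappa> and W :: "'v vol_space" and \<kappa>'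
begin

text \<open>Unitarity and preservation of the volume form say that \<open>f (a \<times> b)\<close> and \<open>f a \<times> f b\<close> have the same
  inner product with every vector \<open>f c\<close>, and these are all vectors of \<open>W\<close>.\<close>

lemma unitary_vol_cross:
  assumes f: "f \<in> unitary_vol V W" and a: "a \<in> carrier V" and b: "b \<in> carrier V"
  shows "f (cross V a b) = cross W (f a) (f b)"
proof (rule W.ip_nondegenerate)
  note f = unitary_volD[OF f]
  show "f (cross V a b) \<in> carrier W" using a b V.cross_closed f(1) by blast
  show "cross W (f a) (f b) \<in> carrier W" using a b W.cross_closed f(1) by blast
  fix c' assume "c' \<in> carrier W"
  then obtain c where c: "c \<in> carrier V" "c' = f c" using f(6) by (auto simp: bij_betw_def)
  show "ip W (f (cross V a b)) c' = ip W (cross W (f a) (f b)) c'"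
    using a b c by (simp add: f(1,4,5) V.cross_closed V.ip_cross W.ip_cross)
qed

lemma O_arr_rooted_iso:
  assumes f: "f \<in> unitary_vol V W"
  shows "O_arr V W f \<in> rooted_iso (O_obj V) (O_obj W)"
proof -
  note hom = unitary_volD[OF f]
  interpret OV: nonassoc_algebra "O_obj V" by (rule V.nonassoc_algebra_O_obj)
  have arr: "O_arr V W f (\<alpha>, a) = (\<alpha>, f a)" if "a \<in> carrier V" for \<alpha> a
    using that by (simp add: O_arr_def)
  have f0: "f \<zero>\<^bsub>V\<^esub> = \<zero>\<^bsub>W\<^esub>"
    using hom(3)[OF V.zero_closed, of 0] hom(1)[OF V.zero_closed]
    by (simp add: V.zero_laws V.zero_closed W.zero_laws)
  have "O_arr V W f \<in> algebra_iso (O_obj V) (O_obj W)"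
  proof (rule algebra_isoI)
    have "bij_betw (map_prod (id :: complex \<Rightarrow> complex) f) (UNIV \<times> carrier V) (UNIV \<times> carrier W)"
      using bij_betw_map_prod[OF bij_id hom(6)] by simp
    moreover have "map_prod (id :: complex \<Rightarrow> complex) f x = O_arr V W f x"
      if "x \<in> UNIV \<times> carrier V" for x
      using that by (auto simp: arr)
    ultimately show "bij_betw (O_arr V W f) (carrier (O_obj V)) (carrier (O_obj W))"
      using bij_betw_cong[of "UNIV \<times> carrier V" "map_prod (id :: complex \<Rightarrow> complex) f" "O_arr V W f"]
      by simp
    fix x y :: "complex \<times> 'v" assume x: "x \<in> carrier (O_obj V)"
    obtain \<alpha> a \<beta> b where xy: "x = (\<alpha>, a)" "y = (\<beta>, b)" by (metis surj_pair)
    have a: "a \<in> carrier V" using x xy by simp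
    show "O_arr V W f (r \<odot>\<^bsub>O_obj V\<^esub> x) = r \<odot>\<^bsub>O_obj W\<^esub> O_arr V W f x" for r
      using a xy V.smult_closed by (simp add: arr hom(3))
    assume "y \<in> carrier (O_obj V)"
    then have b: "b \<in> carrier V" using xy by simp
    have "x \<oplus>\<^bsub>O_obj V\<^esub> y \<in> carrier (O_obj V)" "x \<otimes>\<^bsub>O_obj V\<^esub> y \<in> carrier (O_obj V)"
      using a b xy OV.M.a_closed OV.mult_closed by auto
    then have *: "a \<oplus>\<^bsub>V\<^esub> b \<in> carrier V"
      "cnj \<alpha> \<odot>\<^bsub>V\<^esub> b \<oplus>\<^bsub>V\<^esub> \<beta> \<odot>\<^bsub>V\<^esub> a \<oplus>\<^bsub>V\<^esub> cross V a b \<in> carrier V"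
      by (simp_all add: xy V.O_obj_mult)
    show "O_arr V W f (x \<oplus>\<^bsub>O_obj V\<^esub> y) = O_arr V W f x \<oplus>\<^bsub>O_obj W\<^esub> O_arr V W f y"
      using a b * xy by (simp add: arr hom(2))
    have "(0, cnj \<alpha> \<odot>\<^bsub>V\<^esub> b) \<oplus>\<^bsub>O_obj V\<^esub> (0, \<beta> \<odot>\<^bsub>V\<^esub> a) \<in> carrier (O_obj V)"
      using a b V.smult_closed by (intro OV.M.a_closed) auto
    then have "cnj \<alpha> \<odot>\<^bsub>V\<^esub> b \<oplus>\<^bsub>V\<^esub> \<beta> \<odot>\<^bsub>V\<^esub> a \<in> carrier V" by simp
    then show "O_arr V W f (x \<otimes>\<^bsub>O_obj V\<^esub> y) = O_arr V W f x \<otimes>\<^bsub>O_obj W\<^esub> O_arr V W f y"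
      using a b * xy
      by (simp add: arr V.O_obj_mult W.O_obj_mult hom(2-4) V.smult_closed V.cross_closed
        unitary_vol_cross[OF f])
  next
    show "O_arr V W f \<one>\<^bsub>O_obj V\<^esub> = \<one>\<^bsub>O_obj W\<^esub>"
      by (simp add: arr V.zero_closed f0)
  qed
  then show ?thesis
    by (simp add: rooted_iso_def arr V.zero_closed f0) (simp add: O_arr_def)
qed

lemma O_arr_faithful:
  assumes "f \<in> unitary_vol V W" "f' \<in> unitary_vol V W" "O_arr V W f = O_arr V W f'"
  shows "f = f'"
proof (rule extensionalityI)
  show "f \<in> extensional (carrier V)" "f' \<in> extensional (carrier V)"
    using assms unitary_volD(7) by auto
  show "f a = f' a" if "a \<in> carrier V" for a
    using fun_cong[OF assms(3), of "(0, a)"] that by (simp add: O_arr_def)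
qed

text \<open>An isomorphism \<open>g\<close> that preserves the root fixes \<open>\<complex>\<close>, which is spanned over the reals by \<open>1\<close>
  and the root. It maps \<open>V\<close> to \<open>W\<close>, since these are the elements anticommuting with the root.
  Its restriction \<open>f\<close> to \<open>V\<close> is complex linear because scalar multiplication is the product with
  elements of \<open>\<complex>\<close>. Finally, the two components of the product of two vectors are, up to sign, their
  inner product and their cross product, so \<open>f\<close> preserves both and therefore also
  \<open>\<langle>a \<times> b, c\<rangle>\<close>, the volume form.\<close>

lemma O_arr_full:
  assumes g: "g \<in> rooted_iso (O_obj V) (O_obj W)"
  shows "\<exists>f \<in> unitary_vol V W. O_arr V W f = g"
proof -
  interpret OV: nonassoc_algebra "O_obj V" by (rule V.nonassoc_algebra_O_obj)
  note hom = algebra_isoD[OF rooted_isoD(1)[OF g]] and g_ext = rooted_isoD(2)[OF g]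
    and g_root = rooted_isoD(3)[OF g]
  note z = V.zero_closed W.zero_closed
  have g_scalar: "g (\<alpha>, \<zero>\<^bsub>V\<^esub>) = (\<alpha>, \<zero>\<^bsub>W\<^esub>)" for \<alpha>
  proof -
    have \<alpha>: "of_real (Re \<alpha>) + of_real (Im \<alpha>) * \<i> = \<alpha>" by (simp add: complex_eq_iff)
    have mem: "\<one>\<^bsub>O_obj V\<^esub> \<in> carrier (O_obj V)" "root (O_obj V) \<in> carrier (O_obj V)"
      "Re \<alpha> \<odot>\<^bsub>O_obj V\<^esub> \<one>\<^bsub>O_obj V\<^esub> \<in> carrier (O_obj V)"
      "Im \<alpha> \<odot>\<^bsub>O_obj V\<^esub> root (O_obj V) \<in> carrier (O_obj V)"
      by (simp_all add: z V.smult_closed)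
    have "(\<alpha>, \<zero>\<^bsub>V\<^esub>) = Re \<alpha> \<odot>\<^bsub>O_obj V\<^esub> \<one>\<^bsub>O_obj V\<^esub> \<oplus>\<^bsub>O_obj V\<^esub> Im \<alpha> \<odot>\<^bsub>O_obj V\<^esub> root (O_obj V)"
      by (simp add: V.zero_laws V.smult_zero_right z \<alpha>)
    also have "g \<dots> = Re \<alpha> \<odot>\<^bsub>O_obj W\<^esub> \<one>\<^bsub>O_obj W\<^esub> \<oplus>\<^bsub>O_obj W\<^esub> Im \<alpha> \<odot>\<^bsub>O_obj W\<^esub> root (O_obj W)"
      by (simp only: hom(2)[OF mem(3,4)] hom(3)[OF mem(1)] hom(3)[OF mem(2)] hom(5) g_root)
    also have "\<dots> = (\<alpha>, \<zero>\<^bsub>W\<^esub>)" by (simp add: W.zero_laws W.smult_zero_right z \<alpha>)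
    finally show ?thesis .
  qed
  define f where "f = (\<lambda>a\<in>carrier V. snd (g (0, a)))"
  have f: "f a \<in> carrier W \<and> g (0, a) = (0, f a)" if a: "a \<in> carrier V" for a
  proof -
    obtain \<beta> b where b: "g (0, a) = (\<beta>, b)" by (metis surj_pair)
    have b': "b \<in> carrier W" using hom(1)[of "(0, a)"] a b by simp
    \<comment> \<open>The equation \<open>- v \<i> = \<i> v\<close> holds exactly for the elements \<open>v\<close> without scalar part.\<close>
    have ax: "(- 1) \<odot>\<^bsub>O_obj V\<^esub> ((0, a) \<otimes>\<^bsub>O_obj V\<^esub> (\<i>, \<zero>\<^bsub>V\<^esub>)) = (\<i>, \<zero>\<^bsub>V\<^esub>) \<otimes>\<^bsub>O_obj V\<^esub> (0, a)"
    proof -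
      obtain a1 a2 a3 where "a = \<kappa> (a1, a2, a3)" using a by (rule V.\<kappa>_cases)
      then show ?thesis
        by (simp add: V.O_obj_mult_scalar_left V.O_obj_mult_scalar_right V.\<kappa>_closed
          flip: V.smult)
    qed
    have "(- 1) \<odot>\<^bsub>O_obj W\<^esub> ((\<beta>, b) \<otimes>\<^bsub>O_obj W\<^esub> (\<i>, \<zero>\<^bsub>W\<^esub>)) = (\<i>, \<zero>\<^bsub>W\<^esub>) \<otimes>\<^bsub>O_obj W\<^esub> (\<beta>, b)"
      using arg_cong[OF ax, of g] a z OV.mult_closed[of "(0, a)" "(\<i>, \<zero>\<^bsub>V\<^esub>)"]
      by (simp add: hom(3,4) b g_scalar del: V.O_obj_simps(6) W.O_obj_simps(6))
    then have "\<beta> = 0"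
      using b' by (simp add: W.O_obj_mult_scalar_left W.O_obj_mult_scalar_right)
    then show ?thesis using a b b' by (simp add: f_def)
  qed
  have g_eq: "g (\<alpha>, a) = (\<alpha>, f a)" if a: "a \<in> carrier V" for \<alpha> a
  proof -
    have "g ((\<alpha>, \<zero>\<^bsub>V\<^esub>) \<oplus>\<^bsub>O_obj V\<^esub> (0, a)) = (\<alpha>, \<zero>\<^bsub>W\<^esub>) \<oplus>\<^bsub>O_obj W\<^esub> (0, f a)"
      using a f z by (subst hom(2)) (simp_all add: g_scalar)
    then show ?thesis using a f by (simp add: V.zero_laws W.zero_laws)
  qed
  have f_mult: "(- ip V a b, f (cross V a b)) = (- ip W (f a) (f b), cross W (f a) (f b))"
    if a: "a \<in> carrier V" and b: "b \<in> carrier V" for a b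
    using hom(4)[of "(0, a)" "(0, b)"] a b f
    by (simp add: V.O_obj_mult_vectors W.O_obj_mult_vectors V.cross_closed g_eq)
  have "f \<in> unitary_vol V W"
  proof (rule unitary_volI)
    show "f \<in> extensional (carrier V)" by (simp add: f_def)
    have inj: "inj_on g (UNIV \<times> carrier V)" and img: "g ` (UNIV \<times> carrier V) = UNIV \<times> carrier W"
      using hom(6) by (simp_all add: bij_betw_def)
    show "bij_betw f (carrier V) (carrier W)"
      unfolding bij_betw_def
    proof
      show "inj_on f (carrier V)"
        using inj by (auto simp: inj_on_def g_eq)
      show "f ` carrier V = carrier W"
      proof
        show "f ` carrier V \<subseteq> carrier W" using f by auto
        show "carrier W \<subseteq> f ` carrier V"
        proof
          fix b assume "b \<in> carrier W"
          then have "(0, b) \<in> g ` (UNIV \<times> carrier V)" by (simp add: img)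
          then show "b \<in> f ` carrier V" by (auto simp: g_eq)
        qed
      qed
    qed
    fix a b assume a: "a \<in> carrier V"
    show "f (z \<odot>\<^bsub>V\<^esub> a) = z \<odot>\<^bsub>W\<^esub> f a" for z
      \<comment> \<open>The product with \<open>(\<alpha>, 0)\<close> from the left is scalar multiplication by \<open>cnj \<alpha>\<close>.\<close>
      using hom(4)[of "(cnj z, \<zero>\<^bsub>V\<^esub>)" "(0, a)"] a f z
      by (simp add: V.O_obj_mult_scalar_left W.O_obj_mult_scalar_left g_eq g_scalar V.smult_closed)
    assume b: "b \<in> carrier V"
    show "f (a \<oplus>\<^bsub>V\<^esub> b) = f a \<oplus>\<^bsub>W\<^esub> f b"
    proof -
      have "(0, a) \<oplus>\<^bsub>O_obj V\<^esub> (0, b) \<in> carrier (O_obj V)"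
        using a b by (intro OV.M.a_closed) auto
      then show ?thesis
        using hom(2)[of "(0, a)" "(0, b)"] a b by (simp add: g_eq)
    qed
    show ip: "ip W (f a) (f b) = ip V a b" using f_mult[OF a b] by simp
    fix c assume c: "c \<in> carrier V"
    have "vol W (f a) (f b) (f c) = ip W (cross W (f a) (f b)) (f c)"
      using a b c f by (simp add: W.ip_cross)
    also have "\<dots> = ip W (f (cross V a b)) (f c)" using f_mult[OF a b] by simp
    also have "\<dots> = ip V (cross V a b) c"
      using f_mult[OF V.cross_closed[OF a b] c] by simp
    also have "\<dots> = vol V a b c" using a b c by (simp add: V.ip_cross)
    finally show "vol W (f a) (f b) (f c) = vol V a b c" .
  qed
  moreover have "O_arr V W f = g"
  proof (rule extensionalityI[OF _ g_ext])
    show "O_arr V W f \<in> extensional (carrier (O_obj V))" by (simp add: O_arr_def)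
  qed (auto simp: O_arr_def g_eq)
  ultimately show ?thesis by blast
qed

end

section \<open>The equivalence\<close>

text \<open>Both categories consist of structures with an underlying set and of certain extensional functions
  between these sets.\<close>

lemma category_of_extensional_maps:
  fixes Ob :: "'o set" and H :: "'o \<Rightarrow> 'o \<Rightarrow> ('a \<Rightarrow> 'a) set" and U :: "'o \<Rightarrow> 'a set"
  assumes maps: "\<And>X Y f. f \<in> H X Y \<Longrightarrow> f \<in> U X \<rightarrow> U Y \<and> f \<in> extensional (U X)"
    and ident: "\<And>X. X \<in> Ob \<Longrightarrow> (\<lambda>x\<in>U X. x) \<in> H X X"
    and comp: "\<And>X Y Z f g. X \<in> Ob \<Longrightarrow> f \<in> H X Y \<Longrightarrow> g \<in> H Y Z \<Longrightarrow> compose (U X) g f \<in> H X Z"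
  shows "category \<lparr>Obj = Ob, Hom = H, Ident = (\<lambda>X. \<lambda>x\<in>U X. x),
    Comp = (\<lambda>X Y Z g f. compose (U X) g f)\<rparr>"
proof -
  note maps = maps[THEN conjunct1] maps[THEN conjunct2]
  show ?thesis
    by unfold_locales
      (auto simp: ident comp intro: Id_compose[OF maps] compose_Id[OF maps] compose_assoc[OF maps(1)])
qed

lemma unitary_vol_ident: "volume_space V \<Longrightarrow> (\<lambda>a\<in>carrier V. a) \<in> unitary_vol V V"
proof -
  assume "volume_space V"
  then interpret volume_space V .
  show ?thesis
    by (rule unitary_volI) (auto simp: bij_betw_def inj_on_def)
qed

lemma unitary_vol_compose:
  assumes "volume_space U" and f: "f \<in> unitary_vol U V" and g: "g \<in> unitary_vol V W"
  shows "compose (carrier U) g f \<in> unitary_vol U W"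
proof -
  interpret volume_space U by fact
  note f = unitary_volD[OF f] and g = unitary_volD[OF g]
  show ?thesis
  proof (rule unitary_volI)
    show "bij_betw (compose (carrier U) g f) (carrier U) (carrier W)"
      using f(6) g(6) by (rule bij_betw_compose)
  qed (auto simp: compose_eq f(1-5) g(1-5))
qed

lemma category_volume_cat: "category (volume_cat :: ('v vol_space, 'v \<Rightarrow> 'v) category)"
  unfolding volume_cat_def
  by (rule category_of_extensional_maps)
    (auto simp: unitary_vol_ident unitary_vol_compose dest: unitary_volD)

lemma octonion_objsD:
  assumes "A \<in> octonion_objs"
  shows "nonassoc_algebra A" "root A \<in> carrier A"
    "root A \<otimes>\<^bsub>A\<^esub> root A = \<ominus>\<^bsub>A\<^esub> \<one>\<^bsub>A\<^esub>" "\<exists>f. f \<in> algebra_iso A octonions"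
  using assms by (auto simp: octonion_objs_def)

lemma rooted_iso_maps:
  "f \<in> rooted_iso A B \<Longrightarrow> f \<in> carrier A \<rightarrow> carrier B \<and> f \<in> extensional (carrier A)"
  using rooted_isoD(1,2)[of f A B] algebra_isoD(1)[of f A B] by auto

text \<open>Morphisms are extensional, so maps obtained by composition and inversion have to be restricted.\<close>

lemma rooted_iso_restrict:
  assumes A: "A \<in> octonion_objs" and f: "f \<in> algebra_iso A B" "f (root A) = root B"
  shows "restrict f (carrier A) \<in> rooted_iso A B"
  using nonassoc_algebra.algebra_iso_restrict[OF octonion_objsD(1)[OF A] f(1)]
    octonion_objsD(2)[OF A] f(2)
  by (simp add: rooted_iso_def)

lemma algebra_iso_ident: "(\<lambda>x. x) \<in> algebra_iso A A"
  by (rule algebra_isoI) (auto simp: bij_betw_def)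

lemma rooted_iso_compose:
  assumes A: "A \<in> octonion_objs" and f: "f \<in> rooted_iso A B" and g: "g \<in> rooted_iso B C"
  shows "compose (carrier A) g f \<in> rooted_iso A C"
  using rooted_iso_restrict[OF A algebra_iso_comp[OF rooted_isoD(1)[OF f] rooted_isoD(1)[OF g]]]
    rooted_isoD(3)[OF f] rooted_isoD(3)[OF g]
  by (simp add: compose_def comp_def)

lemma category_octonion_cat: "category (octonion_cat :: ('a rooted_algebra, 'a \<Rightarrow> 'a) category)"
  unfolding octonion_cat_def
  by (rule category_of_extensional_maps)
    (auto simp: rooted_iso_compose rooted_iso_maps rooted_iso_restrict algebra_iso_ident
      dest: rooted_iso_maps)

lemma rooted_iso_invertible:
  assumes A: "A \<in> octonion_objs" and B: "B \<in> octonion_objs" and f: "f \<in> rooted_iso A B"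
  shows "f \<in> isos octonion_cat A B"
proof -
  note iso = rooted_isoD(1)[OF f] and bij = algebra_isoD(6)[OF rooted_isoD(1)[OF f]]
  define g where "g = restrict (inv_into (carrier A) f) (carrier B)"
  have "g \<in> rooted_iso B A"
    unfolding g_def
  proof (rule rooted_iso_restrict[OF B])
    show "inv_into (carrier A) f \<in> algebra_iso B A"
      using iso by (rule nonassoc_algebra.algebra_iso_inverse[OF octonion_objsD(1)[OF A]])
    show "inv_into (carrier A) f (root B) = root A"
      using bij octonion_objsD(2)[OF A] rooted_isoD(3)[OF f]
      by (metis bij_betw_def inv_into_f_f)
  qed
  moreover have "compose (carrier A) g f = (\<lambda>x\<in>carrier A. x)"
    unfolding g_def using bij by (rule compose_inv_into_id)
  moreover have "compose (carrier B) f g = (\<lambda>x\<in>carrier B. x)"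
    unfolding g_def using bij by (intro compose_id_inv_into) (simp add: bij_betw_def)
  ultimately show ?thesis
    using f by (auto simp: isos_def octonion_cat_def)
qed

lemma is_functor_O:
  "is_functor (volume_cat :: ('v vol_space, 'v \<Rightarrow> 'v) category) octonion_cat O_fctr"
  unfolding is_functor_def
proof (intro conjI ballI category_volume_cat category_octonion_cat)
  fix X :: "'v vol_space" assume X: "X \<in> Obj volume_cat"
  then interpret X: volume_space X by (simp add: volume_cat_def)
  obtain \<kappa> where \<kappa>: "unimodular_coordinates X \<kappa>" using X.unimodular_coordinates_exist by blast
  show "on_obj O_fctr X \<in> Obj octonion_cat"
    using unimodular_coordinates.O_obj_in_octonion_objs[OF \<kappa>]
    by (simp add: O_fctr_def octonion_cat_def)
  show "on_arr O_fctr X X (Ident volume_cat X) = Ident octonion_cat (on_obj O_fctr X)"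
    by (auto simp: O_fctr_def octonion_cat_def volume_cat_def O_arr_def O_obj_def restrict_def fun_eq_iff)
  fix Y :: "'v vol_space" and f assume Y: "Y \<in> Obj volume_cat" and f: "f \<in> Hom volume_cat X Y"
  then have f': "f \<in> unitary_vol X Y" by (simp add: volume_cat_def)
  interpret Y: volume_space Y using Y by (simp add: volume_cat_def)
  obtain \<kappa>' where \<kappa>': "unimodular_coordinates Y \<kappa>'" using Y.unimodular_coordinates_exist by blast
  show "on_arr O_fctr X Y f \<in> Hom octonion_cat (on_obj O_fctr X) (on_obj O_fctr Y)"
    using two_unimodular_coordinates.O_arr_rooted_iso[OF two_unimodular_coordinates.intro[OF \<kappa> \<kappa>'] f']
    by (simp add: O_fctr_def octonion_cat_def)
  fix Z :: "'v vol_space" and g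
  show "on_arr O_fctr X Z (Comp volume_cat X Y Z g f) =
      Comp octonion_cat (on_obj O_fctr X) (on_obj O_fctr Y) (on_obj O_fctr Z)
        (on_arr O_fctr Y Z g) (on_arr O_fctr X Y f)"
    using unitary_volD(1)[OF f']
    by (auto simp: O_fctr_def octonion_cat_def volume_cat_def O_arr_def O_obj_def compose_def
      restrict_def fun_eq_iff)
qed

lemma (in nonassoc_algebra) algebra_iso_minus_one:
  assumes f: "f \<in> algebra_iso A octonions"
  shows "f (\<ominus> \<one>) = - \<e>"
proof -
  note hom = algebra_isoD[OF f]
  have "f \<zero> + f \<zero> = f \<zero>"
    using hom(2)[of \<zero> \<zero>] by (simp add: octonions_def)
  moreover have "f (\<ominus> \<one>) + f \<one> = f \<zero>"
    using hom(2)[of "\<ominus> \<one>" \<one>] unit_closed by (simp add: octonions_def M.l_neg)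
  moreover have "f \<one> = \<e>" using hom(5) by (simp add: octonions_def octo_one_def)
  ultimately show ?thesis by (simp add: eq_neg_iff_add_eq_0)
qed

text \<open>The hypothesis on the type provides room for a copy of \<open>\<complex>\<^sup>3\<close>, hence for a space \<open>V\<close> with
  \<open>\<complex> \<oplus> V\<close> isomorphic to the octonions. Any isomorphism from \<open>A\<close> to the octonions may send the
  root of \<open>A\<close> to the wrong square root of \<open>-1\<close>; an automorphism of the octonions corrects this.\<close>

lemma O_essentially_surjective:
  fixes A :: "(complex \<times> 'v) rooted_algebra" and emb :: "real \<Rightarrow> 'v"
  assumes emb: "inj emb" and A: "A \<in> octonion_objs"
  shows "\<exists>V :: 'v vol_space. volume_space V \<and> isos octonion_cat (O_obj V) A \<noteq> {}"
proof -
  obtain j :: "c3 \<Rightarrow> 'v" where "inj j" using complex_3_space_embeds[OF emb] by blast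
  then obtain V :: "'v vol_space" where "unimodular_coordinates V j"
    using unimodular_coordinates_realized by blast
  then interpret V: unimodular_coordinates V j .
  interpret A: nonassoc_algebra A using A by (rule octonion_objsD)
  interpret octonions: nonassoc_algebra octonions by (rule nonassoc_algebra_octonions)
  obtain f where f: "f \<in> algebra_iso A octonions" using octonion_objsD(4)[OF A] by blast
  note root = octonion_objsD(2,3)[OF A]
  define x where "x = f (root A)"
  have "x \<star> x = f (root A \<otimes>\<^bsub>A\<^esub> root A)"
    using algebra_isoD(4)[OF f root(1) root(1)] by (simp add: x_def octonions_def)
  then have "x \<star> x = - \<e>"
    using A.algebra_iso_minus_one[OF f] root(2) by simp
  then obtain \<Phi> where \<Phi>: "linear \<Phi>" "bij \<Phi>" "\<Phi> \<e> = \<e>" "\<Phi> ((\<i>, 0), 0) = x"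
    "\<And>p q. \<Phi> (p \<star> q) = \<Phi> p \<star> \<Phi> q" by (rule octo_automorphism_exists) blast
  have \<Phi>_iso: "\<Phi> \<in> algebra_iso octonions octonions"
    using \<Phi> by (intro algebra_isoI)
      (simp_all add: octonions_def linear_add linear_cmul flip: octo_one_def)
  let ?g = "inv_into (carrier octonions) V.from_octonions"
  let ?f' = "inv_into (carrier A) f"
  let ?h = "?f' \<circ> (\<Phi> \<circ> ?g)"
  have "?h \<in> algebra_iso (O_obj V) A"
    using octonions.algebra_iso_inverse[OF V.from_octonions_iso] \<Phi>_iso A.algebra_iso_inverse[OF f]
    by (intro algebra_iso_comp)
  moreover have "?h (root (O_obj V)) = root A"
  proof -
    have "?g (root (O_obj V)) = ((\<i>, 0), 0)"
      using algebra_isoD(6)[OF V.from_octonions_iso]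
      by (subst V.from_octonions_imaginary_unit[symmetric])
        (auto simp: bij_betw_def octonions_def intro!: inv_into_f_f)
    moreover have "?f' x = root A"
      using algebra_isoD(6)[OF f] root(1) by (simp add: x_def bij_betw_def)
    ultimately show ?thesis by (simp add: \<Phi>(4))
  qed
  ultimately have "restrict ?h (carrier (O_obj V)) \<in> rooted_iso (O_obj V) A"
    by (rule rooted_iso_restrict[OF V.O_obj_in_octonion_objs])
  then show ?thesis
    using rooted_iso_invertible[OF V.O_obj_in_octonion_objs A] V.volume_space by blast
qed

theorem theorem4:
  fixes emb :: "real \<Rightarrow> 'v"
  assumes "inj emb"
  shows "is_functor (volume_cat :: ('v vol_space, 'v \<Rightarrow> 'v) category) octonion_cat O_fctr \<and>
    is_equivalence (volume_cat :: ('v vol_space, 'v \<Rightarrow> 'v) category) octonion_cat O_fctr"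
proof (intro conjI is_functor_O)
  show "is_equivalence (volume_cat :: ('v vol_space, 'v \<Rightarrow> 'v) category) octonion_cat O_fctr"
  proof (rule fully_faithful_essentially_surjective_imp_equivalence[OF is_functor_O])
    fix X Y :: "'v vol_space"
    assume X: "X \<in> Obj volume_cat" and Y: "Y \<in> Obj volume_cat"
    obtain \<kappa> \<kappa>' where "unimodular_coordinates X \<kappa>" "unimodular_coordinates Y \<kappa>'"
      using X Y volume_space.unimodular_coordinates_exist[of X]
        volume_space.unimodular_coordinates_exist[of Y] by (auto simp: volume_cat_def)
    then interpret two_unimodular_coordinates X \<kappa> Y \<kappa>' by (rule two_unimodular_coordinates.intro)
    show "\<exists>f \<in> Hom volume_cat X Y. on_arr O_fctr X Y f = g"
      if "g \<in> Hom octonion_cat (on_obj O_fctr X) (on_obj O_fctr Y)" for g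
      using that O_arr_full by (auto simp: volume_cat_def octonion_cat_def O_fctr_def)
    show "f = f'" if "f \<in> Hom volume_cat X Y" "f' \<in> Hom volume_cat X Y"
      "on_arr O_fctr X Y f = on_arr O_fctr X Y f'" for f f'
      using that O_arr_faithful by (simp add: volume_cat_def O_fctr_def)
  next
    fix A :: "(complex \<times> 'v) rooted_algebra" assume "A \<in> Obj octonion_cat"
    then show "\<exists>X \<in> Obj volume_cat. isos octonion_cat (on_obj O_fctr X) A \<noteq> {}"
      using O_essentially_surjective[OF assms, of A]
      by (auto simp: volume_cat_def octonion_cat_def O_fctr_def)
  qed
qed

end
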